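(* Let $T$ be a text of length $n$. There is a data structure occupying $O(n)$ space (in machine words of $\Theta(\log n)$ bits) such that, given any pattern $P$ of length $m$, all occurrences of $P$ in $T$ can be reported, sorted in text order (i.e., by increasing starting position in $T$), in $O(m + occ)$ time, where $occ$ is the number of occurrences of $P$ in $T$.
   Context: An occurrence of $P$ in $T$ is a position $k$ with $T[k:k+m-1]=P$, where $T[a:b]$ denotes the substring of $T$ from position $a$ to position $b$. *)

theory Defs
  imports Complex_Main
begin

text \<open>Positions in a text are counted from 1, and \<open>substring T a b\<close> is \<open>T[a:b]\<close> with both ends
  included (empty if \<open>b = a - 1\<close>).\<close>

definition substring :: "'a list \<Rightarrow> nat \<Rightarrow> nat \<Rightarrow> 'a list" where
  "substring T a b = take (b + 1 - a) (drop (a - 1) T)"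

definition occurrences :: "'a list \<Rightarrow> 'a list \<Rightarrow> nat set" where
  "occurrences T P =
     {k \<in> {1..length T}. k + length P - 1 \<le> length T \<and> substring T k (k + length P - 1) = P}"

text \<open>A word RAM with \<open>w\<close>-bit words, i.e. natural numbers below \<open>2 ^ w\<close>. It has registers
  (a program uses only finitely many), a random access memory whose cells are addressed by words,
  a read-only input tape and a write-only output tape. Programs do not mention \<open>w\<close>, so that one
  program runs on machines of every word length.\<close>

datatype binop = Add | Sub | Mul | Div | Mod | And | Or | Xor | Shl | Shr

fun apply_binop :: "nat \<Rightarrow> binop \<Rightarrow> nat \<Rightarrow> nat \<Rightarrow> nat" where
  "apply_binop w Add x y = (x + y) mod 2 ^ w"
| "apply_binop w Sub x y = (x + (2 ^ w - y)) mod 2 ^ w"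
| "apply_binop w Mul x y = (x * y) mod 2 ^ w"
| "apply_binop w Div x y = x div y"
| "apply_binop w Mod x y = x mod y"
| "apply_binop w And x y = Bit_Operations.and x y"
| "apply_binop w Or x y = Bit_Operations.or x y"
| "apply_binop w Xor x y = Bit_Operations.xor x y"
| "apply_binop w Shl x y = push_bit y x mod 2 ^ w"
| "apply_binop w Shr x y = drop_bit y x"

type_synonym reg = nat

datatype test = Less reg reg | Leq reg reg | Equal reg reg | Nequal reg reg | Eof | Neof

datatype prog =
    Skip
  | Const reg nat
  | Bin binop reg reg reg
  | Load reg reg
  | Store reg reg
  | Read reg
  | Write reg
  | Seq prog prog
  | Cond test prog prog
  | While test prog

record state =
  regs :: "reg \<Rightarrow> nat"
  mem :: "nat \<Rightarrow> nat"
  inp :: "nat list"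
  out :: "nat list"

fun holds :: "test \<Rightarrow> state \<Rightarrow> bool" where
  "holds (Less a b) s \<longleftrightarrow> regs s a < regs s b"
| "holds (Leq a b) s \<longleftrightarrow> regs s a \<le> regs s b"
| "holds (Equal a b) s \<longleftrightarrow> regs s a = regs s b"
| "holds (Nequal a b) s \<longleftrightarrow> regs s a \<noteq> regs s b"
| "holds Eof s \<longleftrightarrow> inp s = []"
| "holds Neof s \<longleftrightarrow> inp s \<noteq> []"

definition set_reg :: "reg \<Rightarrow> nat \<Rightarrow> state \<Rightarrow> state" where
  "set_reg r v s = s\<lparr>regs := (regs s)(r := v)\<rparr>"

text \<open>\<open>exec w c s t s'\<close>: on a machine with \<open>w\<close>-bit words, \<open>c\<close> started in \<open>s\<close> terminates in \<open>s'\<close>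
  after \<open>t\<close> time units, one for each elementary instruction and each evaluation of a test.
  Reading past the end of the input yields 0.\<close>

inductive exec :: "nat \<Rightarrow> prog \<Rightarrow> state \<Rightarrow> nat \<Rightarrow> state \<Rightarrow> bool" for w :: nat where
  Skip: "exec w Skip s 1 s"
| Const: "exec w (Const r k) s 1 (set_reg r (k mod 2 ^ w) s)"
| Bin: "exec w (Bin f r a b) s 1 (set_reg r (apply_binop w f (regs s a) (regs s b)) s)"
| Load: "exec w (Load r a) s 1 (set_reg r (mem s (regs s a)) s)"
| Store: "exec w (Store a r) s 1 (s\<lparr>mem := (mem s)(regs s a := regs s r)\<rparr>)"
| Read: "exec w (Read r) s 1
    ((set_reg r (case inp s of [] \<Rightarrow> 0 | x # _ \<Rightarrow> x) s)\<lparr>inp := tl (inp s)\<rparr>)"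
| Write: "exec w (Write r) s 1 (s\<lparr>out := out s @ [regs s r]\<rparr>)"
| Seq: "exec w c s t s' \<Longrightarrow> exec w d s' u s'' \<Longrightarrow> exec w (Seq c d) s (t + u) s''"
| CondTrue: "holds b s \<Longrightarrow> exec w c s t s' \<Longrightarrow> exec w (Cond b c d) s (1 + t) s'"
| CondFalse: "\<not> holds b s \<Longrightarrow> exec w d s t s' \<Longrightarrow> exec w (Cond b c d) s (1 + t) s'"
| WhileFalse: "\<not> holds b s \<Longrightarrow> exec w (While b c) s 1 s"
| WhileTrue: "holds b s \<Longrightarrow> exec w c s t s' \<Longrightarrow> exec w (While b c) s' u s'' \<Longrightarrow>
    exec w (While b c) s (1 + t + u) s''"

definition stored :: "nat list \<Rightarrow> state \<Rightarrow> bool" where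
  "stored D s \<longleftrightarrow> (\<forall>i < length D. mem s i = D ! i)"

definition words :: "nat \<Rightarrow> nat list set" where
  "words w = lists {..<2 ^ w}"

text \<open>A query finds the data structure \<open>D\<close> in the first cells of the memory and the argument \<open>P\<close>
  on the input tape. The other memory cells are scratch space with arbitrary contents.\<close>

definition query_state :: "nat \<Rightarrow> nat list \<Rightarrow> nat list \<Rightarrow> state \<Rightarrow> bool" where
  "query_state w D P s \<longleftrightarrow>
     regs s = (\<lambda>_. 0) \<and> (\<forall>a. mem s a < 2 ^ w) \<and> stored D s \<and> inp s = P \<and> out s = []"

text \<open>The query must leave \<open>D\<close> intact, so that it can be followed by further queries.\<close>

definition answers_within ::
    "nat \<Rightarrow> prog \<Rightarrow> nat list \<Rightarrow> nat list \<Rightarrow> nat list \<Rightarrow> nat \<Rightarrow> bool" where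
  "answers_within w Q D P R b \<longleftrightarrow>
     (\<forall>s. query_state w D P s \<longrightarrow>
        (\<exists>t s'. exec w Q s t s' \<and> t \<le> b \<and> out s' = R \<and> stored D s'))"

end

theory Submission
  imports Defs "HOL-Number_Theory.Cong" "HOL-Computational_Algebra.Primes"
    "HOL-Library.List_Lexorder" "HOL-Library.Sublist"
begin

text \<open>The nonempty sets of occurrences of patterns form a laminar family, so there are at most \<open>2 n\<close> of
  them; they are the nodes of the suffix tree. A pattern is located by walking down the tree, comparing
  symbols with the text inside an edge and following edges by means of two perfect hash tables
  (symbol to rank, then node and rank to child).

  In the suffix array, a node of size \<open>s\<close> is an interval, whose entries must be sorted in time \<open>O(s)\<close>.
  For every \<open>j\<close>, the maximal nodes of size at most \<open>2 ^ 2 ^ j\<close> are disjoint, and each leaf stores its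
  rank in the one that contains it, using \<open>2 ^ j\<close> bits. Over all relevant \<open>j\<close> these ranks fill \<open>O(log n)\<close>
  bits and are kept in one word. A node of size \<open>s\<close> is contained in a maximal node of the least level \<open>j\<close>
  with \<open>s \<le> 2 ^ 2 ^ j\<close>, where ranks are \<open>O(s\<^sup>2)\<close>, so two passes of radix sort suffice.\<close>

section \<open>Multiply-shift hashing\<close>

text \<open>Symbols are arbitrary words, so a symbol cannot index an array of size O(n), and a pair
  of node and symbol need not fit into one key. Hence the two dictionaries: the first maps a symbol
  to a rank at most \<open>n\<close>, after which pairs have keys of order n^2. Both use two-level
  perfect hashing in the manner of Fredman, Komlos and Szemeredi. For the output, comparison sorting
  costs a factor log occ, and radix sort on the positions themselves would need a base that grows
  with \<open>n\<close> even if \<open>occ\<close> is small. Ranks below (occ + 1)^2 allow a base of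
  at most occ + 1 with two digits. The field widths 2^j grow geometrically, so the last one
  dominates: the packed ranks stay below (n + 1)^4, and a leaf entry, which also holds its position,
  below (n + 1)^5. The constant 28 in front of the logarithm is generous. All word-size conditions
  follow from 2^20 * (n + 1)^8 \<le> 2^w, and 2^20 \<le> (n + 1)^20 because n > 0.\<close>

definition hash :: "nat \<Rightarrow> nat \<Rightarrow> nat \<Rightarrow> nat \<Rightarrow> nat" where
  "hash w r a x = (a * x mod 2 ^ w) div 2 ^ r"

text \<open>Let \<open>y - x = 2 ^ s * z\<close> with \<open>z\<close> odd. In a collision,
  \<open>a * (y - x)\<close> is modulo \<open>2 ^ w\<close> at cyclic distance less than
  \<open>2 ^ r\<close> from 0, so \<open>a * z\<close> is modulo \<open>2 ^ (w - s)\<close> at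
  distance less than \<open>2 ^ (r - s)\<close>. Multiplication by \<open>z\<close> is injective
  modulo \<open>2 ^ w\<close>; the high \<open>s\<close> bits of the product are free, and the low
  part has at most \<open>2 * 2 ^ (r - s)\<close> values.\<close>

lemma hash_collisions_less:
  assumes "x < y" "y < 2 ^ w" "r \<le> w"
  shows "card {a \<in> {..<2 ^ w}. odd a \<and> hash w r a x = hash w r a y} \<le> 2 * 2 ^ r"
proof -
  let ?A = "{a \<in> {..<2 ^ w}. odd a \<and> hash w r a x = hash w r a y}"
  define d where "d = y - x"
  have d: "d > 0" "d < 2 ^ w" using assms by (auto simp: d_def)
  obtain s z where sz: "d = 2 ^ s * z" "odd z"
    using d(1) by (metis mult.commute multiplicity_decompose' not_gr0 odd_one of_nat_numeral two_is_prime_nat prime_elem_def)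
  have sw: "s < w"
  proof (rule ccontr)
    assume "\<not> s < w"
    then have "(2::nat) ^ w \<le> 2 ^ s" by simp
    also have "\<dots> \<le> d" using sz by (cases z) auto
    finally show False using d by simp
  qed
  define t where "t a = a * z mod 2 ^ (w - s)" for a
  have small: "s < r \<and> (t a < 2 ^ (r - s) \<or> 2 ^ (w - s) - t a < 2 ^ (r - s))" if "a \<in> ?A" for a
  proof -
    from that have a: "odd a" "hash w r a x = hash w r a y" by auto
    define X where "X = a * x mod 2 ^ w"
    define Y where "Y = a * y mod 2 ^ w"
    define u where "u = a * d mod 2 ^ w"
    have XY: "X < 2 ^ w" "Y < 2 ^ w" by (auto simp: X_def Y_def)
    have eq: "X div 2 ^ r = Y div 2 ^ r" using a(2) by (simp add: hash_def X_def Y_def)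
    have "a * y = a * x + a * d" using assms(1) by (simp add: d_def flip: distrib_left)
    then have Yu: "Y = (X + u) mod 2 ^ w" by (simp add: X_def Y_def u_def mod_add_eq)
    have u: "u < 2 ^ w" by (simp add: u_def)
    have cl: "X < Y + 2 ^ r" "Y < X + 2 ^ r"
    proof -
      have "X = X div 2 ^ r * 2 ^ r + X mod 2 ^ r" "Y = X div 2 ^ r * 2 ^ r + Y mod 2 ^ r"
        by (simp add: div_mult_mod_eq, subst eq, simp add: div_mult_mod_eq)
      moreover have "X mod 2 ^ r < 2 ^ r" "Y mod 2 ^ r < 2 ^ r" by auto
      ultimately show "X < Y + 2 ^ r" "Y < X + 2 ^ r" by linarith+
    qed
    \<comment> \<open>\<open>Y\<close> is \<open>X + u\<close> with or without wrap-around; the two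
      cases put \<open>u\<close> near the two ends of its range.\<close>
    have us: "u < 2 ^ r \<or> 2 ^ w - u < 2 ^ r"
    proof (cases "X + u < 2 ^ w")
      case True
      then show ?thesis using Yu cl by simp
    next
      case False
      then have "Y = X + u - 2 ^ w" using Yu XY u by (simp add: mod_if)
      then show ?thesis using cl False u by linarith
    qed
    have ut: "u = 2 ^ s * t a"
    proof -
      have "(2::nat) ^ w = 2 ^ s * 2 ^ (w - s)" using sw by (simp flip: power_add)
      then show ?thesis unfolding u_def t_def sz(1)
        by (metis mult.left_commute mult_mod_right)
    qed
    have tt: "t a > 0" "t a < 2 ^ (w - s)"
    proof -
      \<comment> \<open>Oddness excludes distance 0. Then \<open>u\<close> is a nonzero multiple of
        \<open>2 ^ s\<close>, which forces \<open>s < r\<close> below.\<close>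
      have "odd (a * z)" using a sz by simp
      moreover have "even ((2::nat) ^ (w - s))" using sw by simp
      ultimately have "odd (t a)" unfolding t_def using dvd_mod_iff by blast
      then show "t a > 0" by (cases "t a") auto
      show "t a < 2 ^ (w - s)" by (simp add: t_def)
    qed
    have w: "(2::nat) ^ w = 2 ^ s * 2 ^ (w - s)" using sw by (simp flip: power_add)
    have wu: "2 ^ w - u = 2 ^ s * (2 ^ (w - s) - t a)" by (simp add: w ut right_diff_distrib')
    obtain g where g: "g > 0" "2 ^ s * g < (2::nat) ^ r" "g = t a \<or> g = 2 ^ (w - s) - t a"
      using us ut wu tt by (metis zero_less_diff)
    have sr: "s < r"
    proof (rule ccontr)
      assume "\<not> s < r"
      then have "(2::nat) ^ r \<le> 2 ^ s" by simp
      also have "\<dots> \<le> 2 ^ s * g" using g by simp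
      finally show False using g by simp
    qed
    then have "(2::nat) ^ r = 2 ^ s * 2 ^ (r - s)" by (simp flip: power_add)
    then have "g < 2 ^ (r - s)" using g by simp
    then show ?thesis using g sr by auto
  qed
  show ?thesis
  proof (cases "?A = {}")
    case False
    then have sr: "s < r" using small by blast
    let ?R = "{..<2 ^ (r - s)} \<union> {2 ^ (w - s) - 2 ^ (r - s) ..< 2 ^ (w - s)}"
    define f where "f a = a * z mod 2 ^ w" for a
    let ?g = "\<lambda>a. (f a div 2 ^ (w - s), t a)"
    have dv: "(2::nat) ^ (w - s) dvd 2 ^ w" by (simp add: le_imp_power_dvd)
    have tf: "t a = f a mod 2 ^ (w - s)" for a
      unfolding t_def f_def using dv by (simp add: mod_mod_cancel)
    have inj: "inj_on ?g ?A"
    proof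
      fix a b assume a: "a \<in> ?A" and b: "b \<in> ?A" and e: "?g a = ?g b"
      have "f a = f b" using e by (simp add: tf) (metis div_mult_mod_eq)
      then have "[a * z = b * z] (mod 2 ^ w)" by (simp add: f_def unique_euclidean_semiring_class.cong_def)
      then have "[a = b] (mod 2 ^ w)"
        using sz(2) by (subst (asm) cong_mult_rcancel_nat) auto
      then show "a = b" using a b by (auto simp: unique_euclidean_semiring_class.cong_def)
    qed
    have "?g ` ?A \<subseteq> {..<2 ^ s} \<times> ?R"
    proof
      fix q assume "q \<in> ?g ` ?A"
      then obtain a where a: "a \<in> ?A" and q: "q = ?g a" by blast
      have w: "(2::nat) ^ w = 2 ^ s * 2 ^ (w - s)" using sw by (simp flip: power_add)
      have "f a < 2 ^ s * 2 ^ (w - s)" unfolding w[symmetric] by (simp add: f_def)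
      then have "f a div 2 ^ (w - s) < 2 ^ s" by (simp add: less_mult_imp_div_less)
      moreover have "t a < 2 ^ (w - s)" by (simp add: t_def)
      ultimately show "q \<in> {..<2 ^ s} \<times> ?R" using small[OF a] q by auto
    qed
    then have "card (?g ` ?A) \<le> card ({..<2 ^ s} \<times> ?R :: (nat \<times> nat) set)"
      by (intro card_mono) auto
    also have "\<dots> \<le> 2 ^ s * (2 ^ (r - s) + 2 ^ (r - s))"
    proof -
      have "card (?R :: nat set) \<le> 2 ^ (r - s) + 2 ^ (r - s)"
        by (rule order_trans[OF card_Un_le]) simp
      then show ?thesis by (simp add: card_cartesian_product)
    qed
    also have "\<dots> = 2 * 2 ^ r" using sr by (simp add: distrib_left flip: power_add)
    finally show ?thesis using inj by (simp add: card_image)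
  next
    case True
    then show ?thesis by (simp only: card.empty)
  qed
qed

lemma hash_collisions:
  assumes "x \<noteq> y" "x < 2 ^ w" "y < 2 ^ w" "r \<le> w"
  shows "card {a \<in> {..<2 ^ w}. odd a \<and> hash w r a x = hash w r a y} \<le> 2 * 2 ^ r"
  using hash_collisions_less[of x y w r] hash_collisions_less[of y x w r] assms
  by (cases "x < y") (auto simp: eq_commute)

definition coll :: "(nat \<Rightarrow> nat) \<Rightarrow> nat set \<Rightarrow> (nat \<times> nat) set" where
  "coll h K = {(x, y) \<in> K \<times> K. x \<noteq> y \<and> h x = h y}"

lemma finite_coll [simp]: "finite K \<Longrightarrow> finite (coll h K)"
  unfolding coll_def by (rule finite_subset[of _ "K \<times> K"]) auto

lemma card_odd_below_power: "card {a \<in> {..<2 ^ Suc n}. odd (a::nat)} = 2 ^ n"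
proof -
  have "{a \<in> {..<2 ^ Suc n}. odd (a::nat)} = (\<lambda>i. 2 * i + 1) ` {..<2 ^ n}"
    by (auto elim!: oddE)
  then show ?thesis by (simp add: card_image inj_on_def)
qed

text \<open>Averaging over the \<open>2 ^ (w - 1)\<close> odd multipliers: each of at most N^2
  ordered pairs collides under at most \<open>2 * 2 ^ (w - l)\<close> of them, so the mean number of
  colliding pairs is at most 4 N^2 / 2^l.\<close>

lemma exists_good_hash:
  assumes K: "K \<subseteq> {..<2 ^ w}" "card K = N" and l: "0 < w" "l \<le> w"
  shows "\<exists>a < 2 ^ w. 2 ^ l * card (coll (hash w (w - l) a) K) \<le> 4 * N\<^sup>2"
proof (rule ccontr)
  assume neg: "\<not> ?thesis"
  let ?O = "{a \<in> {..<2 ^ w}. odd (a::nat)}"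
  let ?h = "hash w (w - l)"
  let ?K2 = "{(x, y) \<in> K \<times> K. x \<noteq> y}"
  have fin: "finite K" using K finite_subset by blast
  have fO: "finite ?O" by simp
  have fK2: "finite ?K2" by (rule finite_subset[of _ "K \<times> K"]) (use fin in auto)
  have cO: "card ?O = 2 ^ (w - 1)" using card_odd_below_power[of "w - 1"] l by simp
  have cK2: "card ?K2 \<le> N\<^sup>2"
  proof -
    have "card ?K2 \<le> card (K \<times> K)" using fin by (intro card_mono) auto
    then show ?thesis using K by (simp add: card_cartesian_product power2_eq_square)
  qed
  have "(\<Sum>a\<in>?O. card (coll (?h a) K)) = (\<Sum>a\<in>?O. \<Sum>p\<in>?K2. if ?h a (fst p) = ?h a (snd p) then 1 else 0)"
  proof (rule sum.cong[OF refl])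
    fix a
    have "coll (?h a) K = {p \<in> ?K2. ?h a (fst p) = ?h a (snd p)}" by (auto simp: coll_def)
    then show "card (coll (?h a) K) = (\<Sum>p\<in>?K2. if ?h a (fst p) = ?h a (snd p) then 1 else 0)"
      using fK2 by (simp add: sum.If_cases Int_def)
  qed
  also have "\<dots> = (\<Sum>p\<in>?K2. \<Sum>a\<in>?O. if ?h a (fst p) = ?h a (snd p) then 1 else 0)"
    by (rule sum.swap)
  also have "\<dots> \<le> (\<Sum>p\<in>?K2. 2 * 2 ^ (w - l))"
  proof (rule sum_mono)
    fix p assume p: "p \<in> ?K2"
    have "(\<Sum>a\<in>?O. if ?h a (fst p) = ?h a (snd p) then 1 else 0)
        = card {a \<in> {..<2 ^ w}. odd a \<and> ?h a (fst p) = ?h a (snd p)}"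
      using fO by (simp add: sum.If_cases Int_def conj_ac)
    also have "\<dots> \<le> 2 * 2 ^ (w - l)" using p K by (intro hash_collisions) auto
    finally show "(\<Sum>a\<in>?O. if ?h a (fst p) = ?h a (snd p) then 1 else 0) \<le> (2 * 2 ^ (w - l) :: nat)" .
  qed
  also have "\<dots> \<le> N\<^sup>2 * (2 * 2 ^ (w - l))" using cK2 by simp
  finally have le: "(\<Sum>a\<in>?O. card (coll (?h a) K)) \<le> N\<^sup>2 * (2 * 2 ^ (w - l))" .
  have "4 * N\<^sup>2 * 2 ^ (w - 1) = (\<Sum>a\<in>?O. 4 * N\<^sup>2)" by (simp only: sum_constant cO) simp
  also have "\<dots> < (\<Sum>a\<in>?O. 2 ^ l * card (coll (?h a) K))"
  proof (rule sum_strict_mono)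
    show "?O \<noteq> {}" using cO by (metis card.empty power_eq_0_iff zero_neq_numeral)
  qed (use neg in auto)
  also have "\<dots> \<le> 2 ^ l * (N\<^sup>2 * (2 * 2 ^ (w - l)))" using le by (simp flip: sum_distrib_left)
  also have "\<dots> = 2 * N\<^sup>2 * (2 ^ l * 2 ^ (w - l))" by simp
  also have "(2::nat) ^ l * 2 ^ (w - l) = 2 * 2 ^ (w - 1)"
    using l by (simp flip: power_add power_Suc)
  finally show False by simp
qed

section \<open>Static dictionaries\<close>

text \<open>A bucket is a list \<open>[a, r, k\<^sub>0, v\<^sub>0, k\<^sub>1, v\<^sub>1, \<dots>]\<close> consisting of the parameters of its hash function and
  a table of keys and values. A dictionary is a list \<open>[a, r, o\<^sub>0, o\<^sub>1, \<dots>]\<close> followed by the buckets, which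
  begin at the offsets \<open>o\<^sub>j\<close>. The value 0 stands for an absent key.\<close>

definition bucket_entry :: "nat \<Rightarrow> nat list \<Rightarrow> nat \<Rightarrow> nat" where
  "bucket_entry w R x = 2 + 2 * hash w (R ! 1) (R ! 0) x"

definition is_bucket :: "nat \<Rightarrow> nat list \<Rightarrow> (nat \<Rightarrow> nat) \<Rightarrow> nat set \<Rightarrow> bool" where
  "is_bucket w R f X \<longleftrightarrow> (\<forall>x\<in>X. let q = bucket_entry w R x in
     q + 1 < length R \<and> (if R ! q = x then R ! (q + 1) else 0) = f x)"

definition dict_row :: "nat \<Rightarrow> nat list \<Rightarrow> nat \<Rightarrow> nat" where
  "dict_row w B x = B ! (2 + hash w (B ! 1) (B ! 0) x)"

definition dict_entry :: "nat \<Rightarrow> nat list \<Rightarrow> nat \<Rightarrow> nat" where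
  "dict_entry w B x =
     dict_row w B x + 2 + 2 * hash w (B ! (dict_row w B x + 1)) (B ! dict_row w B x) x"

text \<open>The length conditions keep all cells read by a look-up inside the dictionary, for absent
  keys too; the scratch memory is arbitrary.\<close>

definition is_dict :: "nat \<Rightarrow> nat list \<Rightarrow> (nat \<Rightarrow> nat) \<Rightarrow> bool" where
  "is_dict w B f \<longleftrightarrow> (\<forall>x<2 ^ w.
     2 + hash w (B ! 1) (B ! 0) x < length B \<and> dict_entry w B x + 1 < length B \<and>
     (if B ! dict_entry w B x = x then B ! (dict_entry w B x + 1) else 0) = f x)"

lemma ex_power2_between: "\<exists>l. n < (2::nat) ^ l \<and> 2 ^ l \<le> 2 * n + 1"
proof (induction n)
  case (Suc n)
  then obtain l where l: "n < (2::nat) ^ l" "2 ^ l \<le> 2 * n + 1" by blast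
  show ?case
  proof (cases "Suc n < 2 ^ l")
    case False
    then show ?thesis using l by (intro exI[of _ "Suc l"]) auto
  qed (use l in \<open>auto intro!: exI[of _ l]\<close>)
qed (auto intro!: exI[of _ 0])

lemma hash_less: "l \<le> w \<Longrightarrow> hash w (w - l) a x < 2 ^ l"
proof -
  assume "l \<le> w"
  then have "(2::nat) ^ w = 2 ^ l * 2 ^ (w - l)" by (metis le_add_diff_inverse power_add)
  then have "a * x mod 2 ^ w < 2 ^ l * 2 ^ (w - l)" by simp
  then show ?thesis unfolding hash_def by (rule less_mult_imp_div_less)
qed

text \<open>More than \<open>4 * (card K)\<^sup>2\<close> slots leave less than one colliding pair,
  hence none, by \<open>exists_good_hash\<close>. \<open>X\<close> stands for all words that reach
  the bucket, \<open>K\<close> for those with a value.\<close>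

lemma exists_bucket:
  fixes f :: "nat \<Rightarrow> nat"
  assumes K: "K \<subseteq> {..<2 ^ w}" "finite K" and f: "\<And>x. x \<in> X \<Longrightarrow> f x \<noteq> 0 \<longleftrightarrow> x \<in> K" "K \<subseteq> X"
    "\<And>x. f x < 2 ^ w" and w: "8 * (card K)\<^sup>2 + 1 < 2 ^ w"
  shows "\<exists>R \<in> words w. length R \<le> 4 + 16 * (card K)\<^sup>2 \<and> is_bucket w R f X"
proof -
  obtain l where l: "4 * (card K)\<^sup>2 < (2::nat) ^ l" "2 ^ l \<le> 2 * (4 * (card K)\<^sup>2) + 1"
    using ex_power2_between by blast
  have "(2::nat) ^ l < 2 ^ w" using l(2) w by linarith
  then have lw: "l < w" by simp
  obtain a where a: "a < 2 ^ w" "2 ^ l * card (coll (hash w (w - l) a) K) \<le> 4 * (card K)\<^sup>2"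
    using exists_good_hash[of K w "card K" l] K lw by auto
  let ?h = "hash w (w - l) a"
  have "2 ^ l * card (coll ?h K) < 2 ^ l * 1" using a l by linarith
  then have "card (coll ?h K) = 0" by simp
  then have "coll ?h K = {}" using K by simp
  then have inj: "inj_on ?h K" by (auto simp: coll_def inj_on_def)
  \<comment> \<open>An empty slot holds the key 0, which a query for 0 matches; the value 0 stored
    beside it makes this harmless.\<close>
  define key where "key t = (if \<exists>x\<in>K. ?h x = t then THE x. x \<in> K \<and> ?h x = t else 0)" for t
  define val where "val t = (if \<exists>x\<in>K. ?h x = t then f (key t) else 0)" for t
  have key: "key (?h x) = x" "val (?h x) = f x" if "x \<in> K" for x
  proof -
    have "(THE y. y \<in> K \<and> ?h y = ?h x) = x"
      using that inj by (intro the_equality) (auto dest: inj_onD)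
    moreover have ex: "\<exists>y\<in>K. ?h y = ?h x" using that by blast
    ultimately show 1: "key (?h x) = x" by (simp only: key_def if_True)
    show "val (?h x) = f x" using ex 1 by (simp only: val_def if_True)
  qed
  define R where "R = [a, w - l] @ map (\<lambda>i. if even i then key (i div 2) else val (i div 2)) [0..<2 * 2 ^ l]"
  have len: "length R = 2 + 2 * 2 ^ l" by (simp add: R_def)
  have R01: "R ! 0 = a" "R ! 1 = w - l" by (auto simp: R_def)
  have Rn: "R ! (2 + 2 * t) = key t" "R ! (2 + 2 * t + 1) = val t" if "t < 2 ^ l" for t
    using that by (auto simp: R_def nth_append)
  have "is_bucket w R f X"
    unfolding is_bucket_def Let_def bucket_entry_def R01
  proof (intro ballI conjI)
    fix x assume x: "x \<in> X"
    have t: "?h x < 2 ^ l" using lw by (intro hash_less) simp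
    then show "2 + 2 * ?h x + 1 < length R" by (simp add: len)
    show "(if R ! (2 + 2 * ?h x) = x then R ! (2 + 2 * ?h x + 1) else 0) = f x"
    proof (cases "x \<in> K")
      case True
      then show ?thesis using Rn[OF t] key by simp
    next
      case False
      then have fx: "f x = 0" using f(1)[OF x] by simp
      have "val (?h x) = 0" if "key (?h x) = x"
      proof (cases "\<exists>y\<in>K. ?h y = ?h x")
        case True
        then obtain y where y: "y \<in> K" "?h y = ?h x" by blast
        then have "x = y" using key(1)[OF y(1)] that by metis
        then show ?thesis using y False by simp
      qed (simp add: val_def)
      then show ?thesis using Rn[OF t] fx by simp
    qed
  qed
  moreover have "R \<in> words w"
  proof -
    have "key t < 2 ^ w" for t
    proof (cases "\<exists>x\<in>K. ?h x = t")
      case True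
      then show ?thesis using key K by fastforce
    qed (simp add: key_def)
    moreover have "val t < 2 ^ w" for t using f(3) by (simp add: val_def)
    moreover have "w - l < 2 ^ w" using less_exp[of w] by (meson diff_le_self le_less_trans)
    ultimately show ?thesis using a by (auto simp: words_def R_def)
  qed
  moreover have "length R \<le> 4 + 16 * (card K)\<^sup>2" using len l by simp
  ultimately show ?thesis by blast
qed

lemma nth_concat_offset:
  assumes "j < length xss" "i < length (xss ! j)"
  shows "concat xss ! ((\<Sum>k<j. length (xss ! k)) + i) = xss ! j ! i"
  using assms
proof (induction xss arbitrary: j)
  case (Cons xs xss)
  show ?case
  proof (cases j)
    case (Suc k)
    then have "(\<Sum>k<j. length ((xs # xss) ! k)) = length xs + (\<Sum>k<k. length (xss ! k))"
      by (simp only: Suc sum.lessThan_Suc_shift nth_Cons_0 nth_Cons_Suc)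
    then show ?thesis using Cons Suc by (simp add: nth_append)
  qed (use Cons in \<open>simp add: nth_append\<close>)
qed simp

lemma offset_less_length_concat:
  assumes "j < length xss" "i < length (xss ! j)"
  shows "(\<Sum>k<j. length (xss ! k)) + i < length (concat xss)"
  using assms
proof (induction xss arbitrary: j)
  case (Cons xs xss)
  show ?case
  proof (cases j)
    case (Suc k)
    then have "(\<Sum>k<j. length ((xs # xss) ! k)) = length xs + (\<Sum>k<k. length (xss ! k))"
      by (simp only: Suc sum.lessThan_Suc_shift nth_Cons_0 nth_Cons_Suc)
    then show ?thesis using Cons Suc by simp
  qed (use Cons in simp)
qed simp

text \<open>With more than \<open>N\<close> rows at most \<open>4 * N\<close> ordered pairs collide.
  Together with the diagonal pairs, the squares of the bucket sizes add up to at most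
  \<open>5 * N\<close>, so quadratic buckets take linear space. The length is 2 parameters, at most
  \<open>2 * N + 1\<close> offsets, and buckets of \<open>4 * (2 * N + 1) + 16 * (5 * N)\<close>
  words in all, hence \<open>90 * N + 7\<close>. In the last hypothesis the square serves the bucket
  tables, the rest the offsets.\<close>

lemma exists_dict:
  fixes f :: "nat \<Rightarrow> nat"
  assumes fin: "finite {x. f x \<noteq> 0}" and N: "card {x. f x \<noteq> 0} \<le> N"
    and f: "\<And>x. f x < 2 ^ w" "\<And>x. f x \<noteq> 0 \<Longrightarrow> x < 2 ^ w"
    and w: "8 * N\<^sup>2 + 90 * N + 7 < 2 ^ w"
  shows "\<exists>B \<in> words w. length B \<le> 90 * N + 7 \<and> is_dict w B f"
proof -
  define K where "K = {x. f x \<noteq> 0}"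
  have K: "K \<subseteq> {..<2 ^ w}" "finite K" using fin f by (auto simp: K_def)
  have cK: "card K \<le> N" using N by (simp add: K_def)
  obtain l where l: "N < (2::nat) ^ l" "2 ^ l \<le> 2 * N + 1"
    using ex_power2_between by blast
  have "(2::nat) ^ l < 2 ^ w" using l(2) w by linarith
  then have lw: "l < w" by simp
  obtain a where a: "a < 2 ^ w" "2 ^ l * card (coll (hash w (w - l) a) K) \<le> 4 * (card K)\<^sup>2"
    using exists_good_hash[of K w "card K" l] K lw by auto
  let ?h = "hash w (w - l) a"
  define Kb where "Kb j = {x \<in> K. ?h x = j}" for j
  have hl: "?h x < 2 ^ l" for x using lw by (intro hash_less) simp
  have sq: "(\<Sum>j<2 ^ l. (card (Kb j))\<^sup>2) \<le> 5 * N"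
  proof -
    have un: "K = (\<Union>j<2 ^ l. Kb j)" using hl by (auto simp: Kb_def)
    have "card (coll ?h K) \<le> 4 * N"
    proof (cases "N = 0")
      case True
      then have "K = {}" using cK K by simp
      then show ?thesis by (simp add: coll_def)
    next
      case False
      have "N * card (coll ?h K) \<le> 2 ^ l * card (coll ?h K)" using l by simp
      also have "\<dots> \<le> 4 * N\<^sup>2" using a cK by (meson le_trans mult_le_mono2 power2_nat_le_eq_le)
      finally show ?thesis using False by (simp add: power2_eq_square)
    qed
    moreover have "(\<Sum>j<2 ^ l. (card (Kb j))\<^sup>2) = card (\<Union>j<2 ^ l. Kb j \<times> Kb j)"
      using K by (subst card_UN_disjoint)
        (auto simp: Kb_def card_cartesian_product power2_eq_square)
    moreover have "(\<Union>j<2 ^ l. Kb j \<times> Kb j) \<subseteq> coll ?h K \<union> (\<lambda>x. (x, x)) ` K"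
      by (auto simp: Kb_def coll_def)
    then have "card (\<Union>j<2 ^ l. Kb j \<times> Kb j) \<le> card (coll ?h K \<union> (\<lambda>x. (x, x)) ` K)"
      using K by (intro card_mono) auto
    moreover have "\<dots> \<le> card (coll ?h K) + card ((\<lambda>x. (x, x)) ` K)" by (rule card_Un_le)
    moreover have "card ((\<lambda>x. (x, x)) ` K) \<le> N"
      using K cK by (meson card_image_le le_trans)
    ultimately show ?thesis by linarith
  qed
  define X where "X j = {x \<in> {..<2 ^ w}. ?h x = j}" for j
  have "\<exists>R \<in> words w. length R \<le> 4 + 16 * (card (Kb j))\<^sup>2 \<and> is_bucket w R f (X j)" for j
  proof (rule exists_bucket)
    show "Kb j \<subseteq> {..<2 ^ w}" "finite (Kb j)" "Kb j \<subseteq> X j" using K by (auto simp: Kb_def X_def)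
    show "\<And>x. x \<in> X j \<Longrightarrow> f x \<noteq> 0 \<longleftrightarrow> x \<in> Kb j" by (auto simp: Kb_def X_def K_def)
    show "\<And>x. f x < 2 ^ w" using f by simp
    have "card (Kb j) \<le> N" using K cK by (metis (no_types, lifting) Kb_def card_mono le_trans mem_Collect_eq subsetI)
    then have "(card (Kb j))\<^sup>2 \<le> N\<^sup>2" by (simp add: power_mono)
    then show "8 * (card (Kb j))\<^sup>2 + 1 < 2 ^ w" using w by linarith
  qed
  then obtain R where R: "\<And>j. R j \<in> words w" "\<And>j. length (R j) \<le> 4 + 16 * (card (Kb j))\<^sup>2"
    "\<And>j. is_bucket w (R j) f (X j)" by metis
  define Rs where "Rs = map R [0..<2 ^ l]"
  define off where "off j = 2 + 2 ^ l + (\<Sum>k<j. length (Rs ! k))" for j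
  define B where "B = [a, w - l] @ map off [0..<2 ^ l] @ concat Rs"
  have lRs: "length Rs = 2 ^ l" "\<And>j. j < 2 ^ l \<Longrightarrow> Rs ! j = R j" by (auto simp: Rs_def)
  have "length (concat Rs) = (\<Sum>j<2 ^ l. length (R j))"
    by (simp add: Rs_def length_concat interv_sum_list_conv_sum_set_nat comp_def atLeast0LessThan)
  also have "\<dots> \<le> (\<Sum>j<2 ^ l. 4 + 16 * (card (Kb j))\<^sup>2)" by (intro sum_mono R)
  also have "\<dots> = 4 * 2 ^ l + 16 * (\<Sum>j<2 ^ l. (card (Kb j))\<^sup>2)"
    by (simp add: sum.distrib flip: sum_distrib_left)
  also have "\<dots> \<le> 4 * (2 * N + 1) + 16 * (5 * N)" using sq l by (intro add_mono mult_le_mono) auto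
  finally have lc: "length (concat Rs) \<le> 88 * N + 4" by simp
  have lB: "length B = 2 + 2 ^ l + length (concat Rs)" by (simp add: B_def)
  have len: "length B \<le> 90 * N + 7" using lB lc l by linarith
  have B01: "B ! 0 = a" "B ! 1 = w - l" by (auto simp: B_def)
  have row: "dict_row w B x = off (?h x)" for x
    unfolding dict_row_def B01 using hl[of x] by (simp add: B_def nth_append)
  have Bn: "B ! (off j + i) = R j ! i" "off j + i < length B" if "j < 2 ^ l" "i < length (R j)" for i j
  proof -
    have 1: "j < length Rs" "i < length (Rs ! j)" using that lRs by auto
    have 2: "off j + i = length ([a, w - l] @ map off [0..<2 ^ l]) + ((\<Sum>k<j. length (Rs ! k)) + i)"
      by (simp add: off_def)
    have "B = ([a, w - l] @ map off [0..<2 ^ l]) @ concat Rs" by (simp add: B_def)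
    then have "B ! (off j + i) = concat Rs ! ((\<Sum>k<j. length (Rs ! k)) + i)"
      unfolding 2 by (simp only: nth_append_length_plus)
    then show "B ! (off j + i) = R j ! i" using nth_concat_offset[OF 1] lRs that by simp
    show "off j + i < length B" using offset_less_length_concat[OF 1] by (simp add: lB off_def)
  qed
  have "is_dict w B f"
    unfolding is_dict_def
  proof (intro allI impI)
    fix x :: nat assume x: "x < 2 ^ w"
    define j where "j = ?h x"
    have j: "j < 2 ^ l" using hl by (simp add: j_def)
    define q where "q = bucket_entry w (R j) x"
    have "x \<in> X j" using x by (simp add: X_def j_def)
    then have q: "q + 1 < length (R j)" "(if R j ! q = x then R j ! (q + 1) else 0) = f x"
      using R(3)[of j] by (auto simp: is_bucket_def q_def Let_def)
    have "2 \<le> q" by (simp add: q_def bucket_entry_def)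
    then have "0 < length (R j)" "1 < length (R j)" using q by linarith+
    then have "B ! off j = R j ! 0" "B ! (off j + 1) = R j ! 1"
      using Bn(1)[OF j, of 0] Bn(1)[OF j, of 1] by simp_all
    then have e: "dict_entry w B x = off j + q"
      by (simp add: dict_entry_def row q_def bucket_entry_def flip: j_def)
    have 2: "B ! (off j + q) = R j ! q" "B ! (off j + q + 1) = R j ! (q + 1)"
      using Bn(1)[OF j, of q] Bn(1)[OF j, of "q + 1"] q(1) by (simp_all add: add.assoc)
    show "2 + hash w (B ! 1) (B ! 0) x < length B \<and> dict_entry w B x + 1 < length B \<and>
     (if B ! dict_entry w B x = x then B ! (dict_entry w B x + 1) else 0) = f x"
      unfolding e 2 B01 using q(2) Bn(2)[OF j q(1)] j by (simp add: lB flip: j_def)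
  qed
  moreover have "B \<in> words w"
  proof -
    have "w - l < 2 ^ w" using less_exp[of w] by (meson diff_le_self le_less_trans)
    moreover have "off j < 2 ^ w" if "j < 2 ^ l" for j
    proof -
      have "(\<Sum>k<j. length (Rs ! k)) \<le> (\<Sum>k<2 ^ l. length (Rs ! k))"
        using that by (intro sum_mono2) auto
      also have "\<dots> = length (concat Rs)"
        by (simp add: lRs length_concat sum_list_sum_nth atLeast0LessThan)
      finally show ?thesis using lB len w by (simp add: off_def)
    qed
    moreover have "x < 2 ^ w" if "x \<in> set (concat Rs)" for x
      using that R(1) by (auto simp: Rs_def words_def in_lists_conv_set)
    ultimately show ?thesis using a(1) by (auto simp: words_def B_def simp del: set_concat)
  qed
  ultimately show ?thesis using len by blast
qed

section \<open>Nodes of the suffix tree\<close>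

definition laminar :: "'a set set \<Rightarrow> bool" where
  "laminar F \<longleftrightarrow> (\<forall>A\<in>F. \<forall>B\<in>F. A \<inter> B \<noteq> {} \<longrightarrow> A \<subseteq> B \<or> B \<subseteq> A)"

text \<open>Deleting \<open>x\<close> from all members loses at most two of them:
  \<open>{x}\<close>, which becomes empty, and a single \<open>A\<close> that gets identified with
  \<open>insert x A\<close>.\<close>

lemma card_laminar:
  assumes "finite X" "F \<subseteq> Pow X - {{}}" "laminar F"
  shows "card F \<le> 2 * card X"
  using assms
proof (induction X arbitrary: F rule: finite_induct)
  case (insert x X)
  define G where "G = (\<lambda>A. A - {x}) ` F - {{}}"
  define F1 where "F1 = F - {{x}}"
  have finF: "finite F" using insert.prems insert.hyps by (meson finite_Diff finite_Pow_iff finite_insert rev_finite_subset)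
  have "laminar G"
    unfolding laminar_def
  proof (intro ballI impI)
    fix A B assume A: "A \<in> G" "B \<in> G" "A \<inter> B \<noteq> {}"
    then obtain A' B' where "A' \<in> F" "A = A' - {x}" "B' \<in> F" "B = B' - {x}" by (auto simp: G_def)
    moreover from this have "A' \<subseteq> B' \<or> B' \<subseteq> A'" using insert.prems A by (auto simp: laminar_def)
    ultimately show "A \<subseteq> B \<or> B \<subseteq> A" by auto
  qed
  then have cG: "card G \<le> 2 * card X"
    using insert.prems by (intro insert.IH) (auto simp: G_def)
  \<comment> \<open>\<open>insert x A\<close> and \<open>insert x B\<close> share \<open>x\<close>,
    hence are comparable, say \<open>A \<subseteq> B\<close>. Then \<open>B\<close> meets
    \<open>insert x A\<close> without containing it, so it lies inside and equals
    \<open>A\<close>.\<close>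
  have only: "A = B" if "A \<in> F1" "B \<in> F1" "insert x A \<in> F1" "insert x B \<in> F1" "x \<notin> A" "x \<notin> B" for A B
  proof -
    have lam: "C \<subseteq> D \<or> D \<subseteq> C" if "C \<in> F1" "D \<in> F1" "C \<inter> D \<noteq> {}" for C D
      using insert.prems that by (auto simp: laminar_def F1_def)
    have ne: "A \<noteq> {}" "B \<noteq> {}" using that insert.prems by (auto simp: F1_def)
    have "insert x A \<subseteq> insert x B \<or> insert x B \<subseteq> insert x A" using that by (intro lam) auto
    then have "A \<subseteq> B \<or> B \<subseteq> A" using that by auto
    moreover have "A = B" if *: "A \<subseteq> B" "A \<in> F1" "B \<in> F1" "insert x A \<in> F1" "x \<notin> B" "A \<noteq> {}" for A B
    proof -
      have "B \<subseteq> insert x A \<or> insert x A \<subseteq> B" using * by (intro lam) auto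
      then show ?thesis using * by auto
    qed
    ultimately show ?thesis using that ne by metis
  qed
  define D where "D = {A \<in> F1. x \<notin> A \<and> insert x A \<in> F1}"
  have "card D \<le> 1"
    using only finF by (intro card_le_Suc0_iff_eq[THEN iffD2, unfolded One_nat_def[symmetric]])
      (auto simp: D_def F1_def)
  moreover have "card (F1 - D) \<le> card G"
  proof (rule card_inj_on_le[where f = "\<lambda>A. A - {x}"])
    show "inj_on (\<lambda>A. A - {x}) (F1 - D)"
    proof
      fix A B assume AB: "A \<in> F1 - D" "B \<in> F1 - D" "A - {x} = B - {x}"
      show "A = B"
      proof (cases "x \<in> A \<longleftrightarrow> x \<in> B")
        case True
        then show ?thesis using AB(3) by blast
      next
        case False
        then have "B = insert x A \<and> x \<notin> A \<or> A = insert x B \<and> x \<notin> B" using AB(3) by blast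
        then show ?thesis using AB by (auto simp: D_def)
      qed
    qed
    show "(\<lambda>A. A - {x}) ` (F1 - D) \<subseteq> G"
      using insert.prems by (auto simp: G_def F1_def)
    show "finite G" using finF by (simp add: G_def)
  qed
  moreover have "card F1 = card (F1 - D) + card D"
    using finF by (subst card_Un_disjoint[symmetric]) (auto simp: D_def F1_def intro!: arg_cong[where f = card])
  moreover have "card F \<le> card F1 + 1" using finF
    unfolding F1_def by (cases "{x} \<in> F") (simp_all add: card_Suc_Diff1)
  ultimately show ?case using cG insert.hyps by simp
qed auto

section \<open>Occurrence sets and path labels\<close>

lemma occurrences_eq: "occurrences T P = {k \<in> {1..length T}. prefix P (drop (k - 1) T)}"
proof -
  have "(k + length P - 1 \<le> length T \<and> substring T k (k + length P - 1) = P)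
      = prefix P (drop (k - 1) T)" if k: "1 \<le> k" "k \<le> length T" for k
  proof -
    \<comment> \<open>Since \<open>1 \<le> k\<close>, truncated subtraction loses nothing, even for
      the empty pattern.\<close>
    have 1: "k + length P - 1 + 1 - k = length P" using k by simp
    have "prefix P (drop (k - 1) T) \<longleftrightarrow> take (length P) (drop (k - 1) T) = P"
      by (metis append_eq_conv_conj append_take_drop_id prefix_def)
    moreover have "k + length P - 1 \<le> length T" if "prefix P (drop (k - 1) T)"
      using prefix_length_le[OF that] k by simp
    ultimately show ?thesis unfolding substring_def 1 by blast
  qed
  then show ?thesis by (auto simp: occurrences_def)
qed

definition nodes :: "'a list \<Rightarrow> nat set set" where
  "nodes T = {occurrences T P | P. occurrences T P \<noteq> {}}"

lemma occurrences_subset: "occurrences T P \<subseteq> {1..length T}"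
  by (auto simp: occurrences_eq)

lemma finite_occurrences [simp]: "finite (occurrences T P)"
  using occurrences_subset finite_subset by blast

lemma occurrences_antimono: "prefix P Q \<Longrightarrow> occurrences T Q \<subseteq> occurrences T P"
  by (auto simp: occurrences_eq intro: prefix_order.trans)

lemma prefix_if_common_occurrence:
  "k \<in> occurrences T P \<Longrightarrow> k \<in> occurrences T Q \<Longrightarrow> length P \<le> length Q \<Longrightarrow> prefix P Q"
  by (auto simp: occurrences_eq intro: prefix_length_prefix)

text \<open>If two patterns have a common occurrence, the shorter is a prefix of the longer and
  occurs wherever that does.\<close>

lemma laminar_nodes: "laminar (nodes T)"
  unfolding laminar_def nodes_def
  using prefix_if_common_occurrence occurrences_antimono
  by (smt (verit, ccfv_threshold) disjoint_iff mem_Collect_eq nat_le_linear)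

lemma nodes_subset: "nodes T \<subseteq> Pow {1..length T} - {{}}"
  using occurrences_subset by (fastforce simp: nodes_def)

lemma finite_nodes [simp]: "finite (nodes T)"
  using nodes_subset by (rule finite_subset) simp

lemma card_nodes: "card (nodes T) \<le> 2 * length T"
  using card_laminar[OF _ nodes_subset laminar_nodes, of T] by simp

text \<open>The path label of the node \<open>S\<close> of the suffix tree.\<close>

definition label :: "'a list \<Rightarrow> nat set \<Rightarrow> 'a list" where
  "label T S = arg_max length (\<lambda>P. occurrences T P = S)"

lemma length_le_if_occurs: "occurrences T P \<noteq> {} \<Longrightarrow> length P \<le> length T"
  using prefix_length_le by (fastforce simp: occurrences_eq)

lemma label:
  assumes "S = occurrences T P" "S \<noteq> {}"
  shows occurrences_label: "occurrences T (label T S) = S" and length_label: "length P \<le> length (label T S)"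
proof -
  have *: "\<forall>Q. occurrences T Q = S \<longrightarrow> length Q \<le> length T" using assms length_le_if_occurs by metis
  have "occurrences T (label T S) = S \<and> (\<forall>Q. occurrences T Q = S \<longrightarrow> length Q \<le> length (label T S))"
    unfolding label_def
    by (rule arg_max_nat_lemma[where k = P and b = "Suc (length T)"]) (use assms * in \<open>auto simp: less_Suc_eq_le\<close>)
  then show "occurrences T (label T S) = S" "length P \<le> length (label T S)" using assms by auto
qed

lemma occurrences_label_node: "S \<in> nodes T \<Longrightarrow> occurrences T (label T S) = S"
  unfolding nodes_def using occurrences_label by blast

lemma label_eqI:
  assumes "S = occurrences T P" "S \<noteq> {}" "length P = length (label T S)"
  shows "label T S = P"
proof -
  obtain k where "k \<in> occurrences T P" "k \<in> occurrences T (label T S)"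
    using assms label[OF assms(1,2)] by blast
  then have "prefix P (label T S)" using assms(3) by (intro prefix_if_common_occurrence) auto
  then show ?thesis using assms(3) by (auto simp: prefix_def)
qed

text \<open>All occurrences of \<open>P\<close> continue along the label, so one witness
  \<open>k\<close> tells the next symbol for all of them. This is why the search may read a single
  text position inside an edge.\<close>

lemma occurrences_snoc_inside:
  assumes S: "S = occurrences T P" and k: "k \<in> S" and len: "length P < length (label T S)"
  shows "occurrences T (P @ [c]) = (if T ! (k - 1 + length P) = c then S else {})"
proof -
  let ?W = "label T S"
  have W: "occurrences T ?W = S" using S k by (intro label) auto
  have PW: "prefix P ?W" using S W k len by (intro prefix_if_common_occurrence[of k T]) auto
  have nth: "T ! (j - 1 + length P) = ?W ! length P" if "j \<in> S" for j
  proof -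
    have "prefix ?W (drop (j - 1) T)" using that W by (auto simp: occurrences_eq)
    then have "drop (j - 1) T ! length P = ?W ! length P" using len by (auto simp: prefix_def nth_append)
    moreover have "j - 1 \<le> length T" using that S occurrences_subset[of T P] by fastforce
    ultimately show ?thesis by simp
  qed
  have sub: "occurrences T (P @ [c]) \<subseteq> S" unfolding S by (rule occurrences_antimono) simp
  show ?thesis
  proof (cases "?W ! length P = c")
    case True
    have "prefix (P @ [c]) ?W" using PW len True
      by (auto simp: prefix_def nth_append) (metis Cons_eq_append_conv append_Cons append_eq_conv_conj drop_all
          hd_Cons_tl hd_drop_conv_nth length_append length_drop linorder_not_le nth_Cons_0 self_append_conv2)
    then have "S \<subseteq> occurrences T (P @ [c])" using W occurrences_antimono by blast
    then show ?thesis using sub nth[OF k] True by auto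
  next
    case False
    have "j \<notin> occurrences T (P @ [c])" for j
    proof
      assume j: "j \<in> occurrences T (P @ [c])"
      then have "prefix (P @ [c]) (drop (j - 1) T)" by (auto simp: occurrences_eq)
      then have "drop (j - 1) T ! length P = c" by (auto simp: prefix_def nth_append)
      moreover have "j \<in> S" using j sub by blast
      moreover from this have "j - 1 \<le> length T" using S occurrences_subset[of T P] by fastforce
      ultimately show False using nth[of j] False by simp
    qed
    then show ?thesis using nth[OF k] False by auto
  qed
qed

section \<open>Edges of the suffix tree\<close>

definition edges :: "'a list \<Rightarrow> (nat set \<times> 'a) set" where
  "edges T = {(S, c). S \<in> nodes T \<and> occurrences T (label T S @ [c]) \<noteq> {}}"

text \<open>Charging edges to their targets bounds their number by that of the nodes. If two edges
  share a target and \<open>label T S\<close> is the shorter label, then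
  \<open>label T S @ [c]\<close> is a prefix of \<open>label T S'\<close>, so the target is
  \<open>S'\<close> itself and \<open>label T S' @ [c']\<close> contradicts the maximality of the
  label. For equal lengths a common occurrence identifies the extended labels.\<close>

lemma inj_on_edges: "inj_on (\<lambda>(S, c). occurrences T (label T S @ [c])) (edges T)"
proof -
  have lt: False
    if "length (label T S) < length (label T S')" "S' \<in> nodes T" 
      "occurrences T (label T S @ [c]) = occurrences T (label T S' @ [c'])"
      "occurrences T (label T S' @ [c']) \<noteq> {}" for S S' c c'
  proof -
    let ?P = "label T S @ [c]" and ?Q = "label T S' @ [c']"
    obtain k where k: "k \<in> occurrences T ?P" "k \<in> occurrences T ?Q"
      using \<open>occurrences T (label T S @ [c]) = _\<close> \<open>occurrences T ?Q \<noteq> {}\<close> by (metis all_not_in_conv)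
    have k': "k \<in> occurrences T (label T S')"
      using k occurrences_antimono[of "label T S'" ?Q T] by auto
    have "prefix ?P (label T S')" using k k' that by (intro prefix_if_common_occurrence[of k T]) auto
    then have "occurrences T (label T S') \<subseteq> occurrences T ?Q" using that occurrences_antimono by metis
    then have eq: "occurrences T ?Q = occurrences T (label T S')"
      using occurrences_antimono[of "label T S'" ?Q T] by auto
    also have "\<dots> = S'" using \<open>S' \<in> nodes T\<close> by (rule occurrences_label_node)
    finally have "length ?Q \<le> length (label T S')" using that(4) by (intro length_label) auto
    then show False by simp
  qed
  show ?thesis
  proof (rule inj_onI, clarsimp simp: edges_def)
    fix S c S' c'
    assume a: "S \<in> nodes T" "occurrences T (label T S' @ [c']) \<noteq> {}" "S' \<in> nodes T"
      "occurrences T (label T S @ [c]) = occurrences T (label T S' @ [c'])"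
    have len: "length (label T S) = length (label T S')"
      using lt[of S S' c c'] lt[of S' S c' c] a by (metis linorder_neqE_nat)
    obtain k where k: "k \<in> occurrences T (label T S @ [c])" "k \<in> occurrences T (label T S' @ [c'])"
      using a(2,4) by (metis all_not_in_conv)
    then have "prefix (label T S @ [c]) (label T S' @ [c'])"
      using len by (intro prefix_if_common_occurrence[of k T]) auto
    then have "label T S = label T S'" "c = c'" using len by (auto simp: prefix_def)
    moreover have "occurrences T (label T S) = S" "occurrences T (label T S') = S'"
      using a by (auto simp: occurrences_label_node)
    ultimately show "S = S' \<and> c = c'" by metis
  qed
qed

lemma edges_image: "(\<lambda>(S, c). occurrences T (label T S @ [c])) ` edges T \<subseteq> nodes T"
  by (auto simp: edges_def nodes_def)

lemma finite_edges: "finite (edges T)"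
  using inj_on_edges edges_image finite_nodes by (metis finite_imageD finite_subset)

lemma card_edges: "card (edges T) \<le> 2 * length T"
  using card_inj_on_le[OF inj_on_edges edges_image finite_nodes] card_nodes le_trans by blast

lemma edge_symbol: "(S, c) \<in> edges T \<Longrightarrow> c \<in> set T"
proof -
  assume "(S, c) \<in> edges T"
  then obtain k where "prefix (label T S @ [c]) (drop (k - 1) T)" by (auto simp: edges_def occurrences_eq)
  then have "c \<in> set (drop (k - 1) T)" by (auto simp: prefix_def)
  then show ?thesis using set_drop_subset by fast
qed

section \<open>Nodes as intervals of the suffix array\<close>

definition suffix_array :: "nat list \<Rightarrow> nat list" where
  "suffix_array T = sort_key (\<lambda>k. drop (k - 1) T) [1..<Suc (length T)]"

lemma suffix_array [simp]:
  "set (suffix_array T) = {1..length T}" "length (suffix_array T) = length T" "distinct (suffix_array T)"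
  unfolding suffix_array_def by (simp_all only: set_sort set_upt length_sort length_upt distinct_sort
    distinct_upt atLeastLessThanSuc_atLeastAtMost diff_Suc_1 One_nat_def)

text \<open>The first symbols of \<open>x\<close> and \<open>z\<close> agree and enclose that of
  \<open>y\<close>, and so on by induction. It makes the suffixes that begin with a pattern
  contiguous in the suffix array.\<close>

lemma prefix_convex:
  fixes x y z :: "nat list"
  assumes "x \<le> y" "y \<le> z" "prefix P x" "prefix P z"
  shows "prefix P y"
  using assms
proof (induction P arbitrary: x y z)
  case (Cons c P)
  obtain x' z' where xz: "x = c # x'" "z = c # z'" "prefix P x'" "prefix P z'"
    using Cons.prems(3,4) unfolding prefix_def by (metis append_Cons)
  then obtain d y' where y: "y = d # y'" using Cons.prems by (cases y) auto
  then have "d = c" using xz Cons.prems by auto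
  then show ?case using Cons xz y by auto
qed simp

lemma set_slice:
  assumes "j \<le> length xs"
  shows "set (take (j - i) (drop i xs)) = (!) xs ` {i..<j}"
proof -
  have "take (j - i) (drop i xs) = map ((!) xs) [i..<j]"
    using assms by (intro nth_equalityI) auto
  then show ?thesis by simp
qed

lemma node_interval:
  assumes "S = occurrences T P" "S \<noteq> {}"
  shows "\<exists>l. l + card S \<le> length T \<and> set (take (card S) (drop l (suffix_array T))) = S"
proof -
  let ?A = "suffix_array T"
  define I where "I = {i. i < length T \<and> ?A ! i \<in> S}"
  have finI: "finite I" by (simp add: I_def)
  have "S \<subseteq> set ?A" using assms occurrences_subset by auto
  then have "\<exists>i<length T. ?A ! i = k" if "k \<in> S" for k
    using that by (metis in_set_conv_nth subsetD suffix_array(2))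
  then have SI: "S = (!) ?A ` I" unfolding I_def by (intro subset_antisym subsetI) blast+
  have Ine: "I \<noteq> {}" using SI assms by auto
  have "inj_on ((!) ?A) I" by (rule inj_on_nth) (auto simp: I_def)
  then have cS: "card S = card I" by (simp add: SI card_image)
  have sorted: "drop (?A ! i - 1) T \<le> drop (?A ! j - 1) T" if "i \<le> j" "j < length T" for i j
  proof -
    have "sorted (map (\<lambda>k. drop (k - 1) T) ?A)" by (simp add: suffix_array_def)
    from sorted_nth_mono[OF this, of i j] that show ?thesis by simp
  qed
  have conv: "j \<in> I" if "i \<in> I" "k \<in> I" "i \<le> j" "j \<le> k" for i j k
  proof -
    have jn: "j < length T" using that by (auto simp: I_def)
    have "prefix P (drop (?A ! i - 1) T)" "prefix P (drop (?A ! k - 1) T)"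
      using that assms by (auto simp: I_def occurrences_eq)
    then have "prefix P (drop (?A ! j - 1) T)"
      using that sorted[of i j] sorted[of j k] by (auto simp: I_def intro: prefix_convex)
    moreover have "?A ! j \<in> {1..length T}" using jn nth_mem[of j ?A] by simp
    ultimately show ?thesis using jn assms by (auto simp: I_def occurrences_eq)
  qed
  have I: "I = {Min I..Max I}"
  proof (intro subset_antisym subsetI)
    show "i \<in> I" if "i \<in> {Min I..Max I}" for i
      using conv[OF Min_in[OF finI Ine] Max_in[OF finI Ine]] that by simp
  qed (simp add: finI)
  have mm: "Min I \<le> Max I" using finI Ine by simp
  have c: "card I = Suc (Max I) - Min I" using I card_atLeastAtMost by metis
  have "Max I < length T" using Max_in[OF finI Ine] by (simp add: I_def)
  then have 1: "Min I + card S \<le> length T" using c mm cS by simp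
  have "set (take (card S) (drop (Min I) ?A)) = (!) ?A ` {Min I..<Min I + card S}"
    using set_slice[of "Min I + card S" ?A "Min I"] 1 by simp
  also have "{Min I..<Min I + card S} = {Min I..Max I}" using c cS mm by auto
  also have "\<dots> = I" by (rule I[symmetric])
  finally show ?thesis using 1 SI by blast
qed

section \<open>Ranks inside nodes and radix sort\<close>

definition level_bound :: "nat \<Rightarrow> nat" where
  "level_bound j = 2 ^ 2 ^ j"

lemma level_bound_Suc: "level_bound (Suc j) = level_bound j * level_bound j"
  by (simp add: level_bound_def power_add mult_2)

lemma level_bound_gt: "j < level_bound j"
  unfolding level_bound_def by (meson less_exp order.strict_trans)

lemma level_bound_pos [simp]: "0 < level_bound j"
  by (simp add: level_bound_def)

text \<open>In a laminar family the sets of size at most \<open>b\<close> containing \<open>k\<close> form a chain, so this is the rank of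
  \<open>k\<close> in the largest of them.\<close>

definition cluster_rank :: "nat set set \<Rightarrow> nat \<Rightarrow> nat \<Rightarrow> nat" where
  "cluster_rank F b k = card {y. y < k \<and> (\<exists>S\<in>F. card S \<le> b \<and> k \<in> S \<and> y \<in> S)}"

text \<open>By laminarity the largest set of size at most \<open>b\<close> around \<open>k\<close>
  contains the others, hence all elements counted, and also \<open>k\<close>, which is not
  counted.\<close>

lemma cluster_rank_less:
  assumes "laminar F" "\<And>S. S \<in> F \<Longrightarrow> finite S" "finite F" "0 < b"
  shows "cluster_rank F b k < b"
proof -
  let ?G = "{S \<in> F. card S \<le> b \<and> k \<in> S}"
  let ?X = "{y. y < k \<and> (\<exists>S\<in>F. card S \<le> b \<and> k \<in> S \<and> y \<in> S)}"
  show ?thesis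
  proof (cases "?G = {}")
    case True
    then have "?X = {}" by blast
    then show ?thesis using assms unfolding cluster_rank_def by (simp only: card.empty)
  next
    case False
    have "finite (card ` ?G)" using assms by simp
    then obtain M where M: "M \<in> ?G" "card M = Max (card ` ?G)"
      using False Max_in[of "card ` ?G"] by fastforce
    have "S \<subseteq> M" if S: "S \<in> ?G" for S
    proof -
      have le: "card S \<le> card M" using M(2) S \<open>finite (card ` ?G)\<close> by simp
      have "S \<subseteq> M \<or> M \<subseteq> S" using S M assms(1) by (auto simp: laminar_def)
      moreover have "S = M" if "M \<subseteq> S" using that le S assms(2) by (metis (no_types, lifting) card_seteq mem_Collect_eq)
      ultimately show ?thesis by blast
    qed
    then have "insert k ?X \<subseteq> M" using M by blast
    then have "card (insert k ?X) \<le> card M" using M assms(2) by (intro card_mono) auto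
    moreover have "card M \<le> b" using M by simp
    moreover have "card (insert k ?X) = Suc (card ?X)" by (subst card_insert_disjoint) auto
    ultimately show ?thesis by (simp add: cluster_rank_def)
  qed
qed

text \<open>A set that counts for \<open>k\<close> either contains \<open>S\<close>, and with it
  \<open>k'\<close>, or lies inside \<open>S\<close>, which counts for \<open>k'\<close>. So nothing
  is lost from \<open>k\<close> to \<open>k'\<close>, and \<open>k\<close> itself is gained. One
  bound \<open>b\<close> thus serves all nodes of size up to \<open>b\<close>.\<close>

lemma cluster_rank_strict_mono:
  assumes "laminar F" "S \<in> F" "card S \<le> b" "k \<in> S" "k' \<in> S" "k < k'"
  shows "cluster_rank F b k < cluster_rank F b k'"
  unfolding cluster_rank_def
proof (rule psubset_card_mono)
  let ?X = "\<lambda>k. {y. y < k \<and> (\<exists>S\<in>F. card S \<le> b \<and> k \<in> S \<and> y \<in> S)}"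
  show "finite (?X k')" by simp
  have "?X k \<subseteq> ?X k'"
  proof
    fix y assume "y \<in> ?X k"
    then obtain S' where S': "y < k" "S' \<in> F" "card S' \<le> b" "k \<in> S'" "y \<in> S'" by blast
    then have "S \<subseteq> S' \<or> S' \<subseteq> S" using assms by (auto simp: laminar_def)
    then show "y \<in> ?X k'" using S' assms by auto
  qed
  moreover have "k \<in> ?X k'" using assms by auto
  moreover have "k \<notin> ?X k" by simp
  ultimately show "?X k \<subset> ?X k'" by blast
qed

text \<open>The field of level \<open>j\<close> occupies the bits from \<open>2 ^ j\<close> up to \<open>2 ^ (j + 1) - 1\<close>.\<close>

definition pack :: "(nat \<Rightarrow> nat) \<Rightarrow> nat \<Rightarrow> nat" where
  "pack r J = (\<Sum>j<J. r j * level_bound j)"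

text \<open>Field \<open>J\<close> has weight and range both equal to \<open>level_bound J\<close>,
  whose square is \<open>level_bound (Suc J)\<close>; so consecutive fields abut without
  overlap.\<close>

lemma pack_less:
  assumes "\<And>j. r j < level_bound j"
  shows "pack r J < level_bound J"
proof (induction J)
  case (Suc J)
  have "(r J + 1) * level_bound J \<le> level_bound J * level_bound J"
    using assms[of J] by (intro mult_right_mono) auto
  then show ?case using Suc by (simp add: pack_def level_bound_Suc)
qed (simp add: pack_def)

lemma pack_field:
  assumes "\<And>j. r j < level_bound j" "j < J"
  shows "pack r J div level_bound j mod level_bound j = r j"
proof -
  have "pack r J mod level_bound (Suc j) = pack r (Suc j)"
    using assms(2)
  proof (induction J)
    case (Suc J)
    show ?case
    proof (cases "J = j")
      case True
      then show ?thesis using pack_less[of r "Suc j"] assms(1) by simp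
    next
      case False
      \<comment> \<open>The weights of all higher fields are multiples of
        \<open>level_bound (Suc j)\<close>, so the remainder erases these fields.\<close>
      have "level_bound (Suc j) dvd level_bound J"
        unfolding level_bound_def using False Suc.prems
        by (intro le_imp_power_dvd power_increasing) auto
      then have "pack r (Suc J) mod level_bound (Suc j) = pack r J mod level_bound (Suc j)"
        by (simp add: pack_def) (metis add.right_neutral dvd_eq_mod_eq_0 dvd_mult mod_add_right_eq)
      then show ?thesis using Suc False by simp
    qed
  qed simp
  then have "pack r J div level_bound j mod level_bound j = pack r (Suc j) div level_bound j"
    using mod_mult2_eq[of "pack r J" "level_bound j" "level_bound j"] by (simp flip: level_bound_Suc)
  also have "\<dots> = r j" using pack_less[of r j] assms by (simp add: pack_def)
  finally show ?thesis .
qed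

text \<open>The index is one below the level whose field is consulted: ranks are taken at
  \<open>Suc (level s)\<close>, where they are below the square of
  \<open>level_bound (level s)\<close>, and the latter is the base of the two digits. It exceeds
  \<open>s\<close> only for \<open>s = 1\<close>, where it is 2; hence the bound
  \<open>s + 1\<close> below.\<close>

definition level :: "nat \<Rightarrow> nat" where
  "level s = (LEAST j. s \<le> level_bound (Suc j))"

lemma level: "s \<le> level_bound (Suc (level s))"
  unfolding level_def by (rule LeastI[of _ s]) (meson Suc_lessD level_bound_gt less_imp_le_nat)

lemma level_mono: "s \<le> t \<Longrightarrow> level s \<le> level t"
  unfolding level_def[of s] using level[of t] by (intro Least_le) simp

lemma level_bound_level: "0 < s \<Longrightarrow> level_bound (level s) \<le> s + 1"
proof (cases "level s")
  case 0
  assume "0 < s"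
  then show ?thesis using 0 by (simp add: level_bound_def)
next
  case (Suc j)
  then have "\<not> s \<le> level_bound (Suc j)" unfolding level_def using not_less_Least by (metis lessI)
  then show ?thesis using Suc by simp
qed

section \<open>Stable bucket passes and two-digit radix sort on lists\<close>

definition bucket_pass :: "('a \<Rightarrow> nat) \<Rightarrow> nat \<Rightarrow> 'a list \<Rightarrow> 'a list" where
  "bucket_pass g b xs = concat (map (\<lambda>d. filter (\<lambda>x. g x = d) xs) [0..<b])"

lemma set_bucket_pass: "(\<And>x. x \<in> set xs \<Longrightarrow> g x < b) \<Longrightarrow> set (bucket_pass g b xs) = set xs"
  by (auto simp: bucket_pass_def)

text \<open>Stability: \<open>filter\<close> keeps the order inside a bucket, so the previous order
  \<open>R\<close> survives as a tie-breaker. Two passes, lower digit first, then sort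
  lexicographically.\<close>

lemma sorted_wrt_bucket_pass:
  assumes "sorted_wrt R xs"
  shows "sorted_wrt (\<lambda>x y. g x < g y \<or> g x = g y \<and> R x y) (bucket_pass g b xs)"
proof (induction b)
  case (Suc b)
  have "sorted_wrt (\<lambda>x y. g x < g y \<or> g x = g y \<and> R x y) (filter (\<lambda>x. g x = b) xs)"
    using sorted_wrt_filter[OF assms, of "\<lambda>x. g x = b"]
    by (rule sorted_wrt_mono_rel[rotated]) auto
  then show ?case using Suc by (auto simp: bucket_pass_def sorted_wrt_append)
qed (simp add: bucket_pass_def)

lemma length_bucket_pass:
  assumes "\<And>x. x \<in> set xs \<Longrightarrow> g x < b"
  shows "length (bucket_pass g b xs) = length xs"
proof -
  have "length (bucket_pass g b xs) = length (filter (\<lambda>x. g x < b) xs)"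
  proof (induction b)
    case (Suc b)
    have "length (filter (\<lambda>x. g x < Suc b) xs)
      = length (filter (\<lambda>x. g x < b) xs) + length (filter (\<lambda>x. g x = b) xs)"
      by (induction xs) auto
    then show ?case using Suc by (simp add: bucket_pass_def)
  qed (simp add: bucket_pass_def)
  also have "filter (\<lambda>x. g x < b) xs = xs" using assms by simp
  finally show ?thesis .
qed

text \<open>The digits \<open>h\<close> and \<open>g\<close> need not be digits of \<open>v\<close>,
  only be ordered like \<open>v\<close>: later \<open>v\<close> is the position and the digits are
  those of its rank in a cluster.\<close>

lemma radix_sort:
  assumes "\<And>x. x \<in> set xs \<Longrightarrow> g x < b" "\<And>x. x \<in> set xs \<Longrightarrow> h x < b"
    and "distinct xs" "inj_on v (set xs)"
    and "\<And>x y. x \<in> set xs \<Longrightarrow> y \<in> set xs \<Longrightarrow> v x < v y \<Longrightarrow> h x * b + g x < h y * b + g y"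
  shows "map v (bucket_pass h b (bucket_pass g b xs)) = sorted_list_of_set (v ` set xs)"
proof -
  let ?ys = "bucket_pass g b xs"
  let ?zs = "bucket_pass h b ?ys"
  have s1: "set ?ys = set xs" using assms by (intro set_bucket_pass)
  then have s: "set ?zs = set xs" using assms set_bucket_pass[of ?ys h b] by simp
  have "length ?zs = length ?ys" using assms(2) s1 by (intro length_bucket_pass) auto
  also have "\<dots> = length xs" using assms(1) by (intro length_bucket_pass)
  finally have "length ?zs = length xs" .
  then have "distinct ?zs" using s assms(3) by (metis card_distinct distinct_card)
  then have d: "distinct (map v ?zs)" using assms(4) s by (simp add: distinct_map)
  have "sorted_wrt (\<lambda>x y. True) xs" by (induction xs) auto
  then have "sorted_wrt (\<lambda>x y. h x < h y \<or> h x = h y \<and> (g x < g y \<or> g x = g y \<and> True)) ?zs"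
    by (intro sorted_wrt_bucket_pass)
  then have "sorted_wrt (\<lambda>x y. v x \<le> v y) ?zs"
  proof (rule sorted_wrt_mono_rel[rotated])
    fix x y assume xy: "x \<in> set ?zs" "y \<in> set ?zs" "h x < h y \<or> h x = h y \<and> (g x < g y \<or> g x = g y \<and> True)"
    have "h x * b + g x \<le> h y * b + g y"
    proof (cases "h x < h y")
      case True
      then have "(h x + 1) * b \<le> h y * b" by (intro mult_right_mono) auto
      moreover have "g x < b" using xy s assms by simp
      ultimately show ?thesis by simp
    qed (use xy in auto)
    then show "v x \<le> v y" using assms(5)[of y x] xy s by (metis linorder_not_le)
  qed
  then have "sorted (map v ?zs)" by (simp add: sorted_wrt_map)
  then show ?thesis using d s by (metis list.set_map sorted_list_of_set.idem_if_sorted_distinct)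
qed

section \<open>Weakest preconditions\<close>

text \<open>Like \<open>answers_within\<close>, this asks for the existence of a terminating run.
  Handing the time to the postcondition lets costs add up along a program.\<close>

definition wp :: "nat \<Rightarrow> prog \<Rightarrow> (nat \<Rightarrow> state \<Rightarrow> bool) \<Rightarrow> state \<Rightarrow> bool" where
  "wp w c Q s \<longleftrightarrow> (\<exists>t s'. exec w c s t s' \<and> Q t s')"

lemma exec_iff:
  "exec w Skip s t s' \<longleftrightarrow> t = 1 \<and> s' = s"
  "exec w (Const r k) s t s' \<longleftrightarrow> t = 1 \<and> s' = set_reg r (k mod 2 ^ w) s"
  "exec w (Bin f r a b) s t s' \<longleftrightarrow> t = 1 \<and> s' = set_reg r (apply_binop w f (regs s a) (regs s b)) s"
  "exec w (Load r a) s t s' \<longleftrightarrow> t = 1 \<and> s' = set_reg r (mem s (regs s a)) s"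
  "exec w (Store a r) s t s' \<longleftrightarrow> t = 1 \<and> s' = s\<lparr>mem := (mem s)(regs s a := regs s r)\<rparr>"
  "exec w (Read r) s t s' \<longleftrightarrow>
    t = 1 \<and> s' = (set_reg r (case inp s of [] \<Rightarrow> 0 | x # _ \<Rightarrow> x) s)\<lparr>inp := tl (inp s)\<rparr>"
  "exec w (Write r) s t s' \<longleftrightarrow> t = 1 \<and> s' = s\<lparr>out := out s @ [regs s r]\<rparr>"
  "exec w (Seq c d) s t s'' \<longleftrightarrow> (\<exists>t1 s' t2. exec w c s t1 s' \<and> exec w d s' t2 s'' \<and> t = t1 + t2)"
  "exec w (Cond b' c d) s t s' \<longleftrightarrow> (\<exists>u. exec w (if holds b' s then c else d) s u s' \<and> t = 1 + u)"
  by (subst exec.simps; auto)+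

lemma wp_simps [simp]:
  "wp w Skip Q s \<longleftrightarrow> Q 1 s"
  "wp w (Const r k) Q s \<longleftrightarrow> Q 1 (s\<lparr>regs := (regs s)(r := k mod 2 ^ w)\<rparr>)"
  "wp w (Bin f r a b) Q s \<longleftrightarrow>
    Q 1 (s\<lparr>regs := (regs s)(r := apply_binop w f (regs s a) (regs s b))\<rparr>)"
  "wp w (Load r a) Q s \<longleftrightarrow> Q 1 (s\<lparr>regs := (regs s)(r := mem s (regs s a))\<rparr>)"
  "wp w (Store a r) Q s \<longleftrightarrow> Q 1 (s\<lparr>mem := (mem s)(regs s a := regs s r)\<rparr>)"
  "wp w (Read r) Q s \<longleftrightarrow>
    Q 1 (s\<lparr>regs := (regs s)(r := case inp s of [] \<Rightarrow> 0 | x # _ \<Rightarrow> x), inp := tl (inp s)\<rparr>)"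
  "wp w (Write r) Q s \<longleftrightarrow> Q 1 (s\<lparr>out := out s @ [regs s r]\<rparr>)"
  unfolding wp_def by (auto simp: exec_iff set_reg_def)

lemma wp_Seq [simp]: "wp w (Seq c d) Q s \<longleftrightarrow> wp w c (\<lambda>t. wp w d (\<lambda>u. Q (t + u))) s"
  unfolding wp_def exec_iff by blast

lemma wp_Cond [simp]:
  "wp w (Cond b c d) Q s \<longleftrightarrow>
    (if holds b s then wp w c (\<lambda>t. Q (1 + t)) s else wp w d (\<lambda>t. Q (1 + t)) s)"
  unfolding wp_def exec_iff by (cases "holds b s") auto

text \<open>Keeps the simplifier from evaluating the continuation before its state is known.\<close>

lemma wp_cong [cong]: "c = c' \<Longrightarrow> s = s' \<Longrightarrow> wp w c Q s = wp w c' Q s'"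
  by simp

lemma wp_mono: "wp w c Q s \<Longrightarrow> (\<And>t s'. Q t s' \<Longrightarrow> Q' t s') \<Longrightarrow> wp w c Q' s"
  unfolding wp_def by blast

text \<open>The potential \<open>n\<close> drops in each iteration and so bounds their number. The
  strict \<open>t < k\<close> leaves one unit for the test; the final 1 pays for the test that
  fails.\<close>

lemma wp_While:
  assumes "I n s"
    and step: "\<And>n s. I n s \<Longrightarrow> holds b s \<Longrightarrow> wp w c (\<lambda>t s'. t < k \<and> (\<exists>n'<n. I n' s')) s"
  shows "wp w (While b c) (\<lambda>t s'. t \<le> k * n + 1 \<and> \<not> holds b s' \<and> (\<exists>n'. I n' s')) s"
  using assms(1)
proof (induction n arbitrary: s rule: less_induct)
  case (less n)
  show ?case
  proof (cases "holds b s")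
    case False
    then show ?thesis unfolding wp_def using less.prems exec.WhileFalse by fastforce
  next
    case True
    from step[OF less.prems True] obtain t s' n' where 1: "exec w c s t s'" "t < k" "n' < n" "I n' s'"
      unfolding wp_def by blast
    from less.IH[OF 1(3,4)] obtain u s'' where 2: "exec w (While b c) s' u s''" "u \<le> k * n' + 1"
      "\<not> holds b s''" "\<exists>n'. I n' s''" unfolding wp_def by blast
    have "k * n' + k \<le> k * n" using 1(3) by (metis Suc_leI add.commute mult_Suc_right mult_le_mono2)
    then have "1 + t + u \<le> k * n + 1" using 1 2 by linarith
    then show ?thesis unfolding wp_def using exec.WhileTrue[OF True 1(1) 2(1)] 2 by blast
  qed
qed

fun seq :: "prog list \<Rightarrow> prog" where
  "seq [] = Skip"
| "seq [c] = c"
| "seq (c # d # cs) = Seq c (seq (d # cs))"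

text \<open>Register conventions. Constants of the whole query: 0 and 1 hold the numbers 0 and 1, 2 and 3 the
  addresses of the two dictionaries, 4 the number \<open>n + 1\<close> and 5 the length of the data structure, which
  is where the scratch memory begins. State of the search: 6 is the address of the current node (0 when
  the symbols read so far do not occur), 7 the number of symbols read, 8 the last one. Look-ups take the
  address of a dictionary in 9 and the key in 13, which also receives the value. Sorting uses
  14 (source), 15 (destination), 16 (divisor of the digit), 17 (base), 18 (number of entries) and
  19 (list cells). The others are temporary.\<close>

definition hash_key :: prog where
  "hash_key = seq [Load 10 11, Bin Mul 10 10 13, Bin Add 11 11 1, Load 12 11, Bin Shr 10 10 12,
     Bin Add 11 11 1]"

definition lookup_bucket :: prog where
  "lookup_bucket = seq [hash_key, Bin Add 10 10 10, Bin Add 11 11 10, Load 10 11,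
     Cond (Equal 10 13) (seq [Bin Add 11 11 1, Load 13 11]) (Const 13 0)]"

definition lookup :: prog where
  "lookup = seq [
     Bin Add 11 9 0, hash_key, Bin Add 11 11 10, Load 11 11, Bin Add 11 11 9, lookup_bucket]"

text \<open>Word multiplication reduces modulo \<open>2 ^ w\<close> by itself and the right shift is
  the division. As in the next rule, \<open>Q\<close> is required for any register file
  \<open>R\<close> with the relevant entries, so that temporaries are forgotten.\<close>

lemma wp_hash_key:
  assumes "regs s 1 = 1" "regs s 11 = a" "regs s 13 = key" "a + 2 < 2 ^ w"
    and Q: "\<And>t R. t \<le> 6 \<Longrightarrow> R 10 = hash w (mem s (a + 1)) (mem s a) key \<Longrightarrow> R 11 = a + 2 \<Longrightarrow>
      (\<And>q. q \<notin> {10, 11, 12} \<Longrightarrow> R q = regs s q) \<Longrightarrow> Q t (s\<lparr>regs := R\<rparr>)"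
  shows "wp w hash_key Q s"
  unfolding hash_key_def using assms(1-4)
  by simp (rule Q; simp add: hash_def drop_bit_eq_div)

lemma wp_lookup:
  assumes dict: "is_dict w B f" and B: "\<And>i. i < length B \<Longrightarrow> mem s (a + i) = B ! i"
    and regs: "regs s 0 = 0" "regs s 1 = 1" "regs s 9 = a" "regs s 13 = key" "key < 2 ^ w"
      "a + length B < 2 ^ w"
    and Q: "\<And>t R. t \<le> 25 \<Longrightarrow> R 13 = f key \<Longrightarrow> (\<And>q. q \<notin> {10, 11, 12, 13} \<Longrightarrow> R q = regs s q) \<Longrightarrow>
      Q t (s\<lparr>regs := R\<rparr>)"
  shows "wp w lookup Q s"
proof -
  define h where "h = hash w (B ! 1) (B ! 0) key"
  define rw where "rw = dict_row w B key"
  define h' where "h' = hash w (B ! (rw + 1)) (B ! rw) key"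
  define h2 where "h2 = 2 * h'"
  have e: "dict_entry w B key = rw + 2 + h2" by (simp add: dict_entry_def rw_def h'_def h2_def)
  have rw: "B ! (2 + h) = rw" by (simp add: rw_def dict_row_def h_def)
  have D: "2 + h < length B" "rw + 2 + h2 + 1 < length B"
    "(if B ! (rw + 2 + h2) = key then B ! (rw + 2 + h2 + 1) else 0) = f key"
    using dict[unfolded is_dict_def, rule_format, OF regs(5)] unfolding e by (simp_all only: h_def)
  define p1 p2 p3 where "p1 = a + 2 + h" and "p2 = rw + a + 2 + h2" and "p3 = rw + a + 2 + h2 + 1"
  have len: "0 < length B" "1 < length B" "rw < length B" "rw + 1 < length B" "rw + 2 + h2 < length B"
    using D by linarith+
  have "mem s (a + (rw + 2 + h2 + 1)) = B ! (rw + 2 + h2 + 1)" "mem s (a + (rw + 2 + h2)) = B ! (rw + 2 + h2)"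
    "mem s (a + (2 + h)) = rw"
    using B D len rw by blast+
  moreover have "p3 = a + (rw + 2 + h2 + 1)" "p2 = a + (rw + 2 + h2)" "p1 = a + (2 + h)"
    by (simp_all add: p1_def p2_def p3_def)
  ultimately have m: "mem s p1 = rw" "mem s p2 = B ! (rw + 2 + h2)" "mem s p3 = B ! (rw + 2 + h2 + 1)"
    by (simp_all only:)
  \<comment> \<open>All addresses stay below \<open>a + length B\<close>, so no addition wraps
    around.\<close>
  have mods: "a mod 2 ^ w = a" "(a + 2 + h) mod 2 ^ w = p1" "(rw + a) mod 2 ^ w = rw + a"
    "(h' + h') mod 2 ^ w = h2" "(rw + a + 2 + h2) mod 2 ^ w = p2" "(p2 + 1) mod 2 ^ w = p3"
    using D(1,2) regs(6) by (simp_all add: p1_def p2_def p3_def h2_def)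
  have lt: "a + 2 < 2 ^ w" "rw + a + 2 < 2 ^ w" using D(1,2) regs(6) by linarith+
  have h: "hash w (mem s (a + 1)) (mem s a) key = h"
    using B[OF len(1)] B[OF len(2)] by (simp add: h_def)
  have h': "hash w (mem s (rw + a + 1)) (mem s (rw + a)) key = h'"
    using B[OF len(3)] B[OF len(4)] by (simp add: h'_def ac_simps)
  note [simp del] = One_nat_def add_2_eq_Suc add_2_eq_Suc'
  have hash2: "wp w lookup_bucket (\<lambda>t. Q (k + t)) (s\<lparr>regs := R\<rparr>)"
    if R: "R 11 = rw + a" "\<And>q. q \<notin> {10, 11, 12} \<Longrightarrow> R q = regs s q" and k: "k \<le> 12" for R k
  proof (simp add: lookup_bucket_def, rule wp_hash_key[where a = "rw + a" and key = key])
    fix t :: nat and R'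
    assume R': "t \<le> 6" "R' 10 = hash w (mem (s\<lparr>regs := R\<rparr>) (rw + a + 1)) (mem (s\<lparr>regs := R\<rparr>) (rw + a)) key" "R' 11 = rw + a + 2"
      "\<And>q. q \<notin> {10, 11, 12} \<Longrightarrow> R' q = regs (s\<lparr>regs := R\<rparr>) q"
    have R13: "R' 13 = key" "R' 1 = 1" using R R' regs by auto
    have R10: "R' 10 = h'" using R'(2) h' by simp
    have "B ! (rw + 2 + h2) = key \<Longrightarrow> f key = B ! (rw + 2 + h2 + 1)"
      "B ! (rw + 2 + h2) \<noteq> key \<Longrightarrow> f key = 0" using D(3) by auto
    then show "wp w (Seq (Bin Add 10 10 10) (Seq (Bin Add 11 11 10) (Seq (Load 10 11)
      (Cond (Equal 10 13) (Seq (Bin Add 11 11 1) (Load 13 11)) (Const 13 0)))))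
      (\<lambda>u. Q (k + (t + u))) (s\<lparr>regs := R\<rparr>\<lparr>regs := R'\<rparr>)"
      by (simp add: R13 R10 R'(3) m mods) (use k R R' in \<open>auto intro!: Q simp: fun_upd_def split: if_splits\<close>)
  qed (use regs R lt in simp_all)
  show ?thesis unfolding lookup_def
  proof (simp add: regs mods, rule wp_hash_key[where a = a and key = key])
    fix t :: nat and R
    assume R: "t \<le> 6" "R 10 = hash w (mem (s\<lparr>regs := (regs s)(11 := a)\<rparr>) (a + 1))
        (mem (s\<lparr>regs := (regs s)(11 := a)\<rparr>) a) key" "R 11 = a + 2"
      "\<And>q. q \<notin> {10, 11, 12} \<Longrightarrow> R q = regs (s\<lparr>regs := (regs s)(11 := a)\<rparr>) q"
    have R': "R 10 = h" "R 9 = a" using R h regs by auto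
    show "wp w (Seq (Bin Add 11 11 10) (Seq (Load 11 11) (Seq (Bin Add 11 11 9) lookup_bucket)))
      (\<lambda>u. Q (1 + (t + u))) (s\<lparr>regs := (regs s)(11 := a)\<rparr>\<lparr>regs := R\<rparr>)"
    proof (simp add: R' R(3) m mods, rule wp_mono[OF hash2[where k = "t + 4"]])
      fix u s'
      assume "Q (t + 4 + u) s'"
      moreover have "1 + (t + (1 + (1 + (1 + u)))) = t + 4 + u" by arith
      ultimately show "Q (1 + (t + (1 + (1 + (1 + u))))) s'" by (simp only:)
    qed (use R in simp_all)
  qed (use regs lt(1) in simp_all)
qed

section \<open>Bucket sort on the word RAM\<close>

text \<open>Addresses are to keep the form \<open>a + 1\<close>, \<open>a + 2\<close>.\<close>

declare One_nat_def [simp del] add_2_eq_Suc [simp del] add_2_eq_Suc' [simp del]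

text \<open>Frame condition of the sorting routines: registers 20 to 28 are their temporaries and
  \<open>A\<close> is the memory they may overwrite. \<open>out\<close> is left to the individual
  rules because \<open>emit\<close> extends it.\<close>

definition same_upto :: "state \<Rightarrow> state \<Rightarrow> nat set \<Rightarrow> bool" where
  "same_upto s s' A \<longleftrightarrow> inp s' = inp s \<and> (\<forall>q. q \<notin> {20..28} \<longrightarrow> regs s' q = regs s q) \<and>
    (\<forall>a. a \<notin> A \<longrightarrow> mem s' a = mem s a)"

lemma same_upto_simps:
  assumes "same_upto s s' A"
  shows "inp s' = inp s" "q < 20 \<Longrightarrow> regs s' q = regs s q" "a \<notin> A \<Longrightarrow> mem s' a = mem s a"
  using assms by (auto simp: same_upto_def)

lemma same_upto_trans: "same_upto s s' A \<Longrightarrow> same_upto s' s'' B \<Longrightarrow> A \<subseteq> C \<Longrightarrow> B \<subseteq> C \<Longrightarrow> same_upto s s'' C"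
  unfolding same_upto_def by (metis subsetD)

text \<open>Scratch memory is arbitrary, so the bucket heads must be cleared. This takes time
  proportional to the base, which therefore has to be linear in the number of entries.\<close>

definition clear_heads :: prog where
  "clear_heads = seq [Const 20 0,
     While (Less 20 17) (seq [Bin Add 22 5 20, Store 22 0, Bin Add 20 20 1])]"

lemma wp_clear_heads:
  assumes regs: "regs s 0 = 0" "regs s 1 = 1" "regs s 5 = Z" "regs s 17 = b" "Z + b < 2 ^ w"
    and Q: "\<And>t s'. t \<le> 4 * b + 2 \<Longrightarrow> same_upto s s' {Z..<Z + b} \<Longrightarrow> out s' = out s \<Longrightarrow>
      (\<And>d. d < b \<Longrightarrow> mem s' (Z + d) = 0) \<Longrightarrow> Q t s'"
  shows "wp w clear_heads Q s"
proof -
  define I where "I n s' \<longleftrightarrow> same_upto s s' {Z..<Z + b} \<and> out s' = out s \<and>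
    regs s' 20 \<le> b \<and> n = b - regs s' 20 \<and> (\<forall>d < regs s' 20. mem s' (Z + d) = 0)" for n s'
  have "wp w (While (Less 20 17) (seq [Bin Add 22 5 20, Store 22 0, Bin Add 20 20 1]))
    (\<lambda>t s'. t \<le> 4 * b + 1 \<and> \<not> holds (Less 20 17) s' \<and> (\<exists>n'. I n' s')) (s\<lparr>regs := (regs s)(20 := 0)\<rparr>)"
  proof (rule wp_While)
    show "I b (s\<lparr>regs := (regs s)(20 := 0)\<rparr>)" by (auto simp: I_def same_upto_def)
  next
    fix n s' assume I: "I n s'" and less: "holds (Less 20 17) s'"
    define k where "k = regs s' 20"
    have same: "same_upto s s' {Z..<Z + b}" using I by (simp add: I_def)
    have R': "regs s' 0 = 0" "regs s' 1 = 1" "regs s' 5 = Z" "regs s' 17 = b"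
      using same_upto_simps(2)[OF same] regs by auto
    have k: "k < b" using less by (simp add: k_def R')
    then have mods: "(Z + k) mod 2 ^ w = Z + k" "(k + 1) mod 2 ^ w = k + 1" using regs by auto
    show "wp w (seq [Bin Add 22 5 20, Store 22 0, Bin Add 20 20 1]) (\<lambda>t s'. t < 4 \<and> (\<exists>n'<n. I n' s')) s'"
      using I k by (simp add: R' mods I_def flip: k_def) (auto simp: same_upto_def less_Suc_eq One_nat_def)
  qed
  then show ?thesis unfolding clear_heads_def
    apply simp
    apply (rule wp_mono, assumption)
    apply (rule Q)
    using regs by (auto simp: I_def same_upto_def)
qed

text \<open>A linked list of two-word cells (entry, address of the next cell) between \<open>lo\<close> and \<open>hi\<close>; address 0
  is the null pointer.\<close>

fun cells :: "(nat \<Rightarrow> nat) \<Rightarrow> nat \<Rightarrow> nat \<Rightarrow> nat \<Rightarrow> nat list \<Rightarrow> bool" where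
  "cells M lo hi a [] \<longleftrightarrow> a = 0"
| "cells M lo hi a (x # xs) \<longleftrightarrow>
    a \<noteq> 0 \<and> lo \<le> a \<and> a + 1 < hi \<and> M a = x \<and> cells M lo hi (M (a + 1)) xs"

lemma cells_frame:
  "cells M lo hi a xs \<Longrightarrow> hi \<le> hi' \<Longrightarrow> (\<And>c. lo \<le> c \<Longrightarrow> c < hi \<Longrightarrow> M' c = M c) \<Longrightarrow> cells M' lo hi' a xs"
  by (induction xs arbitrary: a) auto

text \<open>The entries are pushed from last to first, so that every bucket lists them in the original order.\<close>

definition push_all :: prog where
  "push_all = seq [Bin Add 20 18 0, Bin Add 21 19 0,
     While (Nequal 20 0) (seq [Bin Sub 20 20 1, Bin Add 22 14 20, Load 23 22, Store 21 23,
       Bin Div 24 23 16, Bin Mod 24 24 17, Bin Add 24 5 24, Load 25 24, Store 24 21,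
       Bin Add 21 21 1, Store 21 25, Bin Add 21 21 1])]"

lemma wp_push_all:
  assumes regs: "regs s 0 = 0" "regs s 1 = 1" "regs s 5 = Z" "regs s 14 = src" "regs s 16 = p"
      "regs s 17 = b" "regs s 18 = length xs" "regs s 19 = Z + b"
    and bounds: "0 < Z" "Z + b + 2 * length xs < 2 ^ w" "src + length xs < 2 ^ w" "xs \<noteq> [] \<Longrightarrow> 0 < b"
    and src: "\<And>i. i < length xs \<Longrightarrow> mem s (src + i) = xs ! i"
      "\<And>i. i < length xs \<Longrightarrow> src + i \<notin> {Z..<Z + b + 2 * length xs}"
    and heads: "\<And>d. d < b \<Longrightarrow> mem s (Z + d) = 0"
    and Q: "\<And>t s'. t \<le> 13 * length xs + 3 \<Longrightarrow> same_upto s s' {Z..<Z + b + 2 * length xs} \<Longrightarrow> out s' = out s \<Longrightarrow>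
      (\<And>d. d < b \<Longrightarrow> cells (mem s') (Z + b) (Z + b + 2 * length xs) (mem s' (Z + d))
        (filter (\<lambda>x. x div p mod b = d) xs)) \<Longrightarrow> Q t s'"
  shows "wp w push_all Q s"
proof -
  define m where "m = length xs"
  \<comment> \<open>The counter runs down: \<open>n\<close> entries are still to be pushed, and the
    buckets already hold \<open>drop n xs\<close> in order.\<close>
  define I where "I n s' \<longleftrightarrow> same_upto s s' {Z..<Z + b + 2 * m} \<and> out s' = out s \<and>
    n \<le> m \<and> regs s' 20 = n \<and> regs s' 21 = Z + b + 2 * (m - n) \<and>
    (\<forall>d<b. cells (mem s') (Z + b) (Z + b + 2 * (m - n)) (mem s' (Z + d)) (filter (\<lambda>x. x div p mod b = d) (drop n xs)))"
    for n s'
  define body where "body = seq [Bin Sub 20 20 1, Bin Add 22 14 20, Load 23 22, Store 21 23,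
       Bin Div 24 23 16, Bin Mod 24 24 17, Bin Add 24 5 24, Load 25 24, Store 24 21,
       Bin Add 21 21 1, Store 21 25, Bin Add 21 21 1]"
  have mods0: "m mod 2 ^ w = m" "(Z + b) mod 2 ^ w = Z + b" using bounds by (auto simp: m_def)
  have "wp w (While (Nequal 20 0) body)
    (\<lambda>t s'. t \<le> 13 * m + 1 \<and> \<not> holds (Nequal 20 0) s' \<and> (\<exists>n'. I n' s'))
    (s\<lparr>regs := (regs s)(20 := m, 21 := Z + b)\<rparr>)"
  proof (rule wp_While)
    show "I m (s\<lparr>regs := (regs s)(20 := m, 21 := Z + b)\<rparr>)"
      by (auto simp: I_def same_upto_def m_def heads)
  next
    fix n s' assume I: "I n s'" and ne: "holds (Nequal 20 0) s'"
    have same: "same_upto s s' {Z..<Z + b + 2 * m}" and n: "n \<le> m" "regs s' 20 = n"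
      and R21: "regs s' 21 = Z + b + 2 * (m - n)" and out: "out s' = out s"
      and C: "\<And>d. d < b \<Longrightarrow> cells (mem s') (Z + b) (Z + b + 2 * (m - n)) (mem s' (Z + d)) (filter (\<lambda>x. x div p mod b = d) (drop n xs))"
      using I by (auto simp: I_def)
    have R': "regs s' 0 = 0" "regs s' 1 = 1" "regs s' 5 = Z" "regs s' 14 = src" "regs s' 16 = p" "regs s' 17 = b"
      using same_upto_simps(2)[OF same] regs by auto
    have n0: "0 < n" using ne n by (simp add: R')
    define k where "k = n - 1"
    have k: "k < m" "n = Suc k" using n n0 by (auto simp: k_def)
    define q where "q = Z + b + 2 * (m - n)"
    have q: "q + 1 < Z + b + 2 * m" "Z + b \<le> q" "q + 2 = Z + b + 2 * (m - k)" using k by (auto simp: q_def)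
    define e where "e = xs ! k"
    define g where "g = e div p mod b"
    have b: "0 < b" using bounds(4) k by (cases xs) (auto simp: m_def)
    have g: "g < b" using b by (simp add: g_def)
    have e: "mem s' (src + k) = e" using k same_upto_simps(3)[OF same] src by (auto simp: e_def m_def)
    have "n < 2 ^ w" using n bounds by (simp add: m_def)
    \<comment> \<open>\<open>Sub\<close> adds the complement, so the decrement is an addition of
      \<open>2 ^ w - 1\<close>.\<close>
    then have sub: "(n + (2 ^ w - 1)) mod 2 ^ w = k"
    proof -
      have "n + (2 ^ w - 1) = k + 2 ^ w" using k by simp
      then show ?thesis using \<open>n < 2 ^ w\<close> k by simp
    qed
    then have sub': "(n + 2 ^ w - 1) mod 2 ^ w = k" by simp
    have mods: "(src + k) mod 2 ^ w = src + k" "(Z + g) mod 2 ^ w = Z + g"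
      "(q + 1) mod 2 ^ w = q + 1" "(q + 1 + 1) mod 2 ^ w = q + 2"
      using bounds k g q by (auto simp: m_def)
    define M' where "M' = (mem s')(q := e, Z + g := q, q + 1 := mem s' (Z + g))"
    have "q \<noteq> Z + g" "Z + g \<noteq> q" using q g by auto
    then have "wp w body (\<lambda>t s''. t = 12 \<and> mem s'' = M' \<and> inp s'' = inp s' \<and> out s'' = out s' \<and>
      regs s'' 20 = k \<and> regs s'' 21 = q + 2 \<and> (\<forall>q. q \<notin> {20..28} \<longrightarrow> regs s'' q = regs s' q)) s'"
      unfolding body_def M'_def
      by (simp add: R' n R21 sub sub' e mods flip: q_def g_def)
    then show "wp w body (\<lambda>t s'. t < 13 \<and> (\<exists>n'<n. I n' s')) s'"
    proof (rule wp_mono)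
      fix t :: nat and s'' :: state
      assume *: "t = 12 \<and> mem s'' = M' \<and> inp s'' = inp s' \<and> out s'' = out s' \<and>
        regs s'' 20 = k \<and> regs s'' 21 = q + 2 \<and> (\<forall>q. q \<notin> {20..28} \<longrightarrow> regs s'' q = regs s' q)"
      have "I k s''" unfolding I_def
      proof (intro conjI allI impI)
        have "same_upto s' s'' {Z..<Z + b + 2 * m}"
          using * q g by (auto simp: same_upto_def M'_def)
        with same show "same_upto s s'' {Z..<Z + b + 2 * m}" by (rule same_upto_trans) auto
        show "regs s'' 21 = Z + b + 2 * (m - k)" using * q by simp
        fix d assume d: "d < b"
        have dr: "drop k xs = e # drop n xs" using k by (simp add: e_def m_def Cons_nth_drop_Suc)
        \<comment> \<open>Older cells lie above the heads and below the new cell \<open>q\<close>,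
          so the push leaves their lists intact.\<close>
        have fr: "M' c = mem s' c" if "Z + b \<le> c" "c < Z + b + 2 * (m - n)" for c
          using that g by (auto simp: M'_def q_def)
        have c: "cells M' (Z + b) (Z + b + 2 * (m - k)) (mem s' (Z + d)) (filter (\<lambda>x. x div p mod b = d) (drop n xs))"
          using C[OF d] _ fr by (rule cells_frame) (use k in auto)
        show "cells (mem s'') (Z + b) (Z + b + 2 * (m - k)) (mem s'' (Z + d)) (filter (\<lambda>x. x div p mod b = d) (drop k xs))"
        proof (cases "d = g")
          case True
          have "M' (Z + d) = q" "M' q = e" "M' (q + 1) = mem s' (Z + d)"
            using True q g by (auto simp: M'_def)
          moreover have "q \<noteq> 0" "q + 1 < Z + b + 2 * (m - k)" using q bounds by auto
          ultimately show ?thesis using c q True * by (simp add: dr g_def)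
        next
          case False
          then have "M' (Z + d) = mem s' (Z + d)" using q d by (auto simp: M'_def)
          then show ?thesis using c False * by (simp add: dr g_def)
        qed
      qed (use * k out in auto)
      then show "t < 13 \<and> (\<exists>n'<n. I n' s'')" using * k by auto
    qed
  qed
  then show ?thesis unfolding push_all_def body_def
    apply (simp add: regs mods0 flip: m_def)
    apply (rule wp_mono, assumption)
    apply (rule Q)
    using regs by (auto simp: m_def I_def same_upto_def)
qed

text \<open>A single loop, which either opens the next bucket or copies one cell. Its potential is
  the number of unopened buckets plus that of missing entries, which gives the additive bound
  without nested loops.\<close>

definition traverse :: prog where
  "traverse = seq [Const 25 0, Const 26 0, Bin Add 27 15 0, Bin Add 28 15 18,
     While (Nequal 27 28) (Cond (Equal 25 0)
       (seq [Bin Add 22 5 26, Load 25 22, Bin Add 26 26 1])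
       (seq [Load 23 25, Store 27 23, Bin Add 27 27 1, Bin Add 25 25 1, Load 25 25]))]"

lemma wp_traverse:
  assumes regs: "regs s 0 = 0" "regs s 1 = 1" "regs s 5 = Z" "regs s 15 = dst" "regs s 18 = length xs"
    and bounds: "hi \<le> dst" "Z + b \<le> hi" "dst + length xs < 2 ^ w"
    and g: "\<And>x. x \<in> set xs \<Longrightarrow> g x < b"
    and C: "\<And>d. d < b \<Longrightarrow> cells (mem s) lo hi (mem s (Z + d)) (filter (\<lambda>x. g x = d) xs)"
    and Q: "\<And>t s'. t \<le> 7 * (b + length xs) + 5 \<Longrightarrow> same_upto s s' {dst..<dst + length xs} \<Longrightarrow> out s' = out s \<Longrightarrow>
      (\<And>i. i < length xs \<Longrightarrow> mem s' (dst + i) = bucket_pass g b xs ! i) \<Longrightarrow> Q t s'"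
  shows "wp w traverse Q s"
proof -
  define m where "m = length xs"
  define ys where "ys = bucket_pass g b xs"
  have len: "length ys = m" using g by (simp add: ys_def m_def length_bucket_pass)
  \<comment> \<open>\<open>rest\<close> is the unread part of the current list, \<open>j\<close> the
    next bucket, \<open>k\<close> the number of entries written. Lists are described in the initial
    memory \<open>mem s\<close>: the destination starts beyond all cells.\<close>
  define J where "J n s' j k rest \<longleftrightarrow> n = (b - j) + (m - k) \<and> same_upto s s' {dst..<dst + m} \<and> out s' = out s \<and>
    j \<le> b \<and> k \<le> m \<and> regs s' 26 = j \<and> regs s' 27 = dst + k \<and> regs s' 28 = dst + m \<and>
    (\<forall>i<k. mem s' (dst + i) = ys ! i) \<and> cells (mem s) lo hi (regs s' 25) rest \<and>
    drop k ys = rest @ concat (map (\<lambda>d. filter (\<lambda>x. g x = d) xs) [j..<b])" for n s' j k rest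
  define body where "body = Cond (Equal 25 0)
       (seq [Bin Add 22 5 26, Load 25 22, Bin Add 26 26 1])
       (seq [Load 23 25, Store 27 23, Bin Add 27 27 1, Bin Add 25 25 1, Load 25 25])"
  define R0 where "R0 = (regs s)(25 := 0, 26 := 0, 27 := dst, 28 := dst + m)"
  have mods0: "dst mod 2 ^ w = dst" "(dst + m) mod 2 ^ w = dst + m" using bounds by (auto simp: m_def)
  have "wp w (While (Nequal 27 28) body)
    (\<lambda>t s'. t \<le> 7 * (b + m) + 1 \<and> \<not> holds (Nequal 27 28) s' \<and> (\<exists>n' j k rest. J n' s' j k rest))
    (s\<lparr>regs := R0\<rparr>)"
  proof (rule wp_While)
    have "J (b + m) (s\<lparr>regs := R0\<rparr>) 0 0 []"
      by (auto simp: J_def R0_def ys_def bucket_pass_def same_upto_def)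
    then show "\<exists>j k rest. J (b + m) (s\<lparr>regs := R0\<rparr>) j k rest" by blast
  next
    fix n s' assume "\<exists>j k rest. J n s' j k rest" and ne: "holds (Nequal 27 28) s'"
    then obtain j k rest where n: "n = (b - j) + (m - k)" and same: "same_upto s s' {dst..<dst + m}"
      and jk: "j \<le> b" "k \<le> m" "regs s' 26 = j" "regs s' 27 = dst + k" "regs s' 28 = dst + m"
      and W: "\<And>i. i < k \<Longrightarrow> mem s' (dst + i) = ys ! i" and cl: "cells (mem s) lo hi (regs s' 25) rest"
      and D: "drop k ys = rest @ concat (map (\<lambda>d. filter (\<lambda>x. g x = d) xs) [j..<b])"
      and out: "out s' = out s"
      unfolding J_def by blast
    note M = same_upto_simps(3)[OF same]
    have R': "regs s' 0 = 0" "regs s' 1 = 1" "regs s' 5 = Z" using same_upto_simps(2)[OF same] regs by auto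
    have km: "k < m" using ne jk by simp
    show "wp w body (\<lambda>t s'. t < 7 \<and> (\<exists>n'<n. \<exists>j k rest. J n' s' j k rest)) s'"
    proof (cases rest)
      case Nil
      then have R25: "regs s' 25 = 0" using cl by simp
      \<comment> \<open>With the current list exhausted and output missing, some bucket is left; so
        the program needs no test on \<open>j\<close>.\<close>
      have jb: "j < b"
      proof (rule ccontr)
        assume "\<not> j < b"
        then have "drop k ys = []" using D Nil by simp
        then show False using km len by simp
      qed
      have mods: "(Z + j) mod 2 ^ w = Z + j" "(j + 1) mod 2 ^ w = j + 1" using jb bounds by auto
      have Ms: "mem s' (Z + j) = mem s (Z + j)" using jb bounds by (intro M) auto
      have up: "[j..<b] = j # [j + 1..<b]" using jb by (simp add: upt_conv_Cons One_nat_def)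
      have "J ((b - (j + 1)) + (m - k)) s'' (j + 1) k (filter (\<lambda>x. g x = j) xs)"
        if "same_upto s' s'' {}" "out s'' = out s'" "regs s'' 25 = mem s' (Z + j)" "regs s'' 26 = j + 1"
          "regs s'' 27 = dst + k" "regs s'' 28 = dst + m" for s''
        unfolding J_def
      proof (intro conjI)
        show "same_upto s s'' {dst..<dst + m}" using same that(1) by (rule same_upto_trans) auto
      qed (use that out jb jk W same_upto_simps(3)[OF that(1)] C[OF jb] Ms D Nil up in auto)
      moreover have "(b - (j + 1)) + (m - k) < n" using jb n by simp
      ultimately have "\<exists>n'<n. \<exists>j k rest. J n' s'' j k rest"
        if "same_upto s' s'' {}" "out s'' = out s'" "regs s'' 25 = mem s' (Z + j)" "regs s'' 26 = j + 1"
          "regs s'' 27 = dst + k" "regs s'' 28 = dst + m" for s''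
        using that by blast
      then show ?thesis unfolding body_def
        by (simp add: R' R25 jk mods) (simp add: same_upto_def jk)
    next
      case (Cons e rest')
      then have x: "regs s' 25 \<noteq> 0" "regs s' 25 + 1 < hi" "mem s (regs s' 25) = e"
        "cells (mem s) lo hi (mem s (regs s' 25 + 1)) rest'"
        using cl by auto
      have Mx: "mem s' (regs s' 25) = e" "mem s' (regs s' 25 + 1) = mem s (regs s' 25 + 1)"
        using x bounds by (auto simp: M)
      have "ys ! k # drop (Suc k) ys = drop k ys" using km len by (simp add: Cons_nth_drop_Suc)
      then have yk: "ys ! k = e" "drop (k + 1) ys = rest' @ concat (map (\<lambda>d. filter (\<lambda>x. g x = d) xs) [j..<b])"
        using D Cons by (auto simp: One_nat_def)
      have mods: "(dst + k + 1) mod 2 ^ w = dst + k + 1" "(regs s' 25 + 1) mod 2 ^ w = regs s' 25 + 1"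
        using km bounds x by (auto simp: m_def)
      have ne': "regs s' 25 + 1 \<noteq> dst + k" using x bounds by simp
      have "J ((b - j) + (m - (k + 1))) s'' j (k + 1) rest'"
        if "same_upto s' s'' {dst + k}" "mem s'' (dst + k) = e" "out s'' = out s'"
          "regs s'' 25 = mem s' (regs s' 25 + 1)" "regs s'' 26 = j"
          "regs s'' 27 = dst + k + 1" "regs s'' 28 = dst + m" for s''
        unfolding J_def
      proof (intro conjI)
        show "same_upto s s'' {dst..<dst + m}" using same that(1) by (rule same_upto_trans) (use km in auto)
        show "\<forall>i<k + 1. mem s'' (dst + i) = ys ! i"
          using W that(2) yk(1) same_upto_simps(3)[OF that(1)] by (auto simp: less_Suc_eq One_nat_def)
      qed (use that out km jk x yk(2) Mx in auto)
      moreover have "(b - j) + (m - (k + 1)) < n" using km n by simp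
      ultimately have "\<exists>n'<n. \<exists>j k rest. J n' s'' j k rest"
        if "same_upto s' s'' {dst + k}" "mem s'' (dst + k) = e" "out s'' = out s'"
          "regs s'' 25 = mem s' (regs s' 25 + 1)" "regs s'' 26 = j"
          "regs s'' 27 = dst + k + 1" "regs s'' 28 = dst + m" for s''
        using that by blast
      then show ?thesis unfolding body_def
        using x(1) ne' by (simp add: R' jk mods Mx) (simp add: same_upto_def jk Mx)
    qed
  qed
  then show ?thesis unfolding traverse_def body_def R0_def
    apply (simp add: regs mods0 flip: m_def)
    apply (rule wp_mono, assumption)
    apply (rule Q)
    using regs by (auto simp: m_def ys_def J_def)
qed


definition radix_pass :: prog where
  "radix_pass = seq [clear_heads, push_all, traverse]"

text \<open>From \<open>Z\<close> on lie \<open>b\<close> heads, two words of list cell per entry,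
  and the output. The source must avoid only the first two areas: every entry has been copied to a
  cell before output is written. So the second pass may read and overwrite the output of the
  first.\<close>

lemma wp_radix_pass:
  assumes regs: "regs s 0 = 0" "regs s 1 = 1" "regs s 5 = Z" "regs s 14 = src"
      "regs s 15 = Z + b + 2 * length xs" "regs s 16 = p"
      "regs s 17 = b" "regs s 18 = length xs" "regs s 19 = Z + b"
    and bounds: "0 < Z" "Z + b + 3 * length xs < 2 ^ w" "src + length xs < 2 ^ w" "xs \<noteq> [] \<Longrightarrow> 0 < b"
    and src: "\<And>i. i < length xs \<Longrightarrow> mem s (src + i) = xs ! i"
      "\<And>i. i < length xs \<Longrightarrow> src + i \<notin> {Z..<Z + b + 2 * length xs}"
    and Q: "\<And>t s'. t \<le> 20 * (b + length xs) + 10 \<Longrightarrow> same_upto s s' {Z..<Z + b + 3 * length xs} \<Longrightarrow>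
      out s' = out s \<Longrightarrow>
      (\<And>i. i < length xs \<Longrightarrow>
        mem s' (Z + b + 2 * length xs + i) = bucket_pass (\<lambda>x. x div p mod b) b xs ! i) \<Longrightarrow> Q t s'"
  shows "wp w radix_pass Q s"
  unfolding radix_pass_def seq.simps wp_Seq
proof (rule wp_clear_heads[OF regs(1,2,3,7)])
  show "Z + b < 2 ^ w" using bounds by simp
  fix t1 s1
  assume 1: "t1 \<le> 4 * b + 2" "same_upto s s1 {Z..<Z + b}" "out s1 = out s" "\<And>d. d < b \<Longrightarrow> mem s1 (Z + d) = 0"
  note r1 = same_upto_simps[OF 1(2)]
  show "wp w push_all (\<lambda>t. wp w traverse (\<lambda>u. Q (t1 + (t + u)))) s1"
  proof (rule wp_push_all[where Z = Z and b = b and p = p and xs = xs and src = src])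
    show "mem s1 (src + i) = xs ! i" if "i < length xs" for i
      using r1(3)[of "src + i"] src(1)[OF that] src(2)[OF that] by fastforce
    fix t2 s2
    assume 2: "t2 \<le> 13 * length xs + 3" "same_upto s1 s2 {Z..<Z + b + 2 * length xs}" "out s2 = out s1"
      "\<And>d. d < b \<Longrightarrow> cells (mem s2) (Z + b) (Z + b + 2 * length xs) (mem s2 (Z + d))
        (filter (\<lambda>x. x div p mod b = d) xs)"
    note r2 = same_upto_simps[OF 2(2)]
    show "wp w traverse (\<lambda>u. Q (t1 + (t2 + u))) s2"
    proof (rule wp_traverse[where Z = Z and b = b and xs = xs and g = "\<lambda>x. x div p mod b"
            and lo = "Z + b" and hi = "Z + b + 2 * length xs" and dst = "Z + b + 2 * length xs"])
      show "x div p mod b < b" if "x \<in> set xs" for x using that bounds(4) by (cases xs) auto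
      fix t3 s3
      assume 3: "t3 \<le> 7 * (b + length xs) + 5"
        "same_upto s2 s3 {Z + b + 2 * length xs..<Z + b + 2 * length xs + length xs}" "out s3 = out s2"
        "\<And>i. i < length xs \<Longrightarrow> mem s3 (Z + b + 2 * length xs + i) = bucket_pass (\<lambda>x. x div p mod b) b xs ! i"
      have "same_upto s s2 {Z..<Z + b + 3 * length xs}"
        using 1(2) 2(2) by (rule same_upto_trans) auto
      then have "same_upto s s3 {Z..<Z + b + 3 * length xs}"
        using 3(2) by (rule same_upto_trans) auto
      then show "Q (t1 + (t2 + t3)) s3" using 1 2 3 by (intro Q) auto
    qed (use regs r1 r2 2 bounds in auto)
  qed (use regs r1 1 src bounds in auto)
qed

definition emit :: prog where
  "emit = seq [Bin Add 27 15 0, Bin Add 28 15 18,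
     While (Nequal 27 28) (seq [Load 23 27, Bin Mod 23 23 4, Write 23, Bin Add 27 27 1])]"

lemma wp_emit:
  assumes regs: "regs s 0 = 0" "regs s 1 = 1" "regs s 15 = a" "regs s 18 = length xs" "regs s 4 = r"
    and bounds: "a + length xs < 2 ^ w"
    and xs: "\<And>i. i < length xs \<Longrightarrow> mem s (a + i) = xs ! i"
    and Q: "\<And>t s'. t \<le> 5 * length xs + 3 \<Longrightarrow> same_upto s s' {} \<Longrightarrow>
      out s' = out s @ map (\<lambda>x. x mod r) xs \<Longrightarrow> Q t s'"
  shows "wp w emit Q s"
proof -
  define m where "m = length xs"
  define I where "I n s' \<longleftrightarrow> same_upto s s' {} \<and> (\<exists>k. n = m - k \<and> k \<le> m \<and> regs s' 27 = a + k \<and> regs s' 28 = a + m \<and>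
    out s' = out s @ map (\<lambda>x. x mod r) (take k xs))" for n s'
  define body where "body = seq [Load 23 27, Bin Mod 23 23 4, Write 23, Bin Add 27 27 1]"
  have mods0: "a mod 2 ^ w = a" "(a + m) mod 2 ^ w = a + m" using bounds by (auto simp: m_def)
  have "wp w (While (Nequal 27 28) body)
    (\<lambda>t s'. t \<le> 5 * m + 1 \<and> \<not> holds (Nequal 27 28) s' \<and> (\<exists>n'. I n' s'))
    (s\<lparr>regs := (regs s)(27 := a, 28 := a + m)\<rparr>)"
  proof (rule wp_While)
    show "I m (s\<lparr>regs := (regs s)(27 := a, 28 := a + m)\<rparr>)"
      by (auto simp: I_def same_upto_def intro!: exI[of _ 0])
  next
    fix n s' assume "I n s'" and ne: "holds (Nequal 27 28) s'"
    then obtain k where k: "n = m - k" "k \<le> m" "regs s' 27 = a + k" "regs s' 28 = a + m"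
      and out: "out s' = out s @ map (\<lambda>x. x mod r) (take k xs)" and same: "same_upto s s' {}"
      unfolding I_def by blast
    have R': "regs s' 1 = 1" "regs s' 4 = r" using same_upto_simps(2)[OF same] regs by auto
    have km: "k < m" using ne k by simp
    have mods: "(a + k + 1) mod 2 ^ w = a + k + 1" using km bounds by (simp add: m_def)
    have e: "mem s' (a + k) = xs ! k" using same_upto_simps(3)[OF same] xs km by (simp add: m_def)
    have tk: "take (k + 1) xs = take k xs @ [xs ! k]" using km by (simp add: m_def take_Suc_conv_app_nth One_nat_def)
    have "wp w body (\<lambda>t s''. t = 4 \<and> same_upto s s'' {} \<and> regs s'' 27 = a + (k + 1) \<and> regs s'' 28 = a + m \<and>
      out s'' = out s @ map (\<lambda>x. x mod r) (take (k + 1) xs)) s'"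
      unfolding body_def using same by (simp add: k R' e mods out tk) (simp add: same_upto_def)
    then show "wp w body (\<lambda>t s'. t < 5 \<and> (\<exists>n'<n. I n' s')) s'"
      by (rule wp_mono) (use km k in \<open>auto simp: I_def intro!: exI[of _ "m - (k + 1)"] exI[of _ "k + 1"]\<close>)
  qed
  then show ?thesis unfolding emit_def body_def
    apply (simp add: regs mods0 flip: m_def)
    apply (rule wp_mono, assumption)
    apply (rule Q)
    using regs by (auto simp: m_def I_def same_upto_def)
qed

section \<open>The query program\<close>

text \<open>Only the outcome of the two passes is recorded, so the query is verified independently
  of how the entries encode ranks. \<open>p * b\<close> must fit into a word because the query
  computes it, and \<open>b \<le> card S + 1\<close> makes the passes linear. Allowing
  \<open>b = 0\<close> without entries admits the record of the empty set.\<close>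

definition leaves_ok :: "nat \<Rightarrow> nat list \<Rightarrow> nat \<Rightarrow> nat set \<Rightarrow> nat \<Rightarrow> bool" where
  "leaves_ok w D r S a \<longleftrightarrow> (\<exists>xs b p src. length xs = card S \<and> a + 8 \<le> length D \<and>
     D ! (a + 2) = src \<and> D ! (a + 3) = card S \<and> D ! (a + 4) = b \<and> D ! (a + 5) = p \<and>
     src + card S \<le> length D \<and> (\<forall>i<card S. D ! (src + i) = xs ! i) \<and>
     b \<le> card S + 1 \<and> (xs \<noteq> [] \<longrightarrow> 0 < b) \<and> p * b < 2 ^ w \<and>
     map (\<lambda>x. x mod r) (bucket_pass (\<lambda>x. x div (p * b) mod b) b (bucket_pass (\<lambda>x. x div p mod b) b xs))
       = sorted_list_of_set S)"

text \<open>A node record has 8 words: length of the label, address of an occurrence in the copy of the text,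
  address of the leaf entries, their number, sorting base, divisor of the lower digit, and two unused
  ones. The record at address 0 belongs to the empty set; as only its words 0, 3 and 4 have
  to vanish, the others double as the header of the data structure.\<close>

locale text_index =
  fixes w :: nat and T D :: "nat list" and addr :: "nat set \<Rightarrow> nat" and rank child :: "nat \<Rightarrow> nat"
    and n tb d1 d2 :: nat and B1 B2 :: "nat list"
  assumes n: "n = length T"
    and D: "D \<in> words w" "length D + 4 * (n + 1) < 2 ^ w"
    and hdr: "7 < length D" "D ! 0 = 0" "D ! 1 = d1" "D ! 2 = d2" "D ! 5 = n + 1" "D ! 6 = length D"
    and dict1: "is_dict w B1 rank" "d1 + length B1 \<le> length D" "\<And>i. i < length B1 \<Longrightarrow> D ! (d1 + i) = B1 ! i"
    and dict2: "is_dict w B2 child" "d2 + length B2 \<le> length D" "\<And>i. i < length B2 \<Longrightarrow> D ! (d2 + i) = B2 ! i"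
    and symbols: "tb + n \<le> length D" "\<And>i. i < n \<Longrightarrow> D ! (tb + i) = T ! i"
    and leaves: "\<And>S. S \<in> insert {} (nodes T) \<Longrightarrow> leaves_ok w D (n + 1) S (addr S)"
    and addr: "addr {} = 0" "addr (occurrences T []) = 8"
    and depth: "\<And>S. S \<in> nodes T \<Longrightarrow> D ! addr S = length (label T S)"
    and witness: "\<And>S. S \<in> nodes T \<Longrightarrow> \<exists>k\<in>S. D ! (addr S + 1) = tb + (k - 1)"
    and rank: "\<And>c. rank c \<le> n" "\<And>S. S \<in> nodes T \<Longrightarrow> addr S * (n + 1) + n < 2 ^ w"
    and child: "\<And>S c. S \<in> nodes T \<Longrightarrow> c < 2 ^ w \<Longrightarrow>
        child (addr S * (n + 1) + rank c) = addr (occurrences T (label T S @ [c]))"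
      "\<And>c. c < 2 ^ w \<Longrightarrow> child (rank c) = 0"

definition init :: prog where
  "init = seq [Const 1 1, Load 2 1, Const 20 2, Load 3 20, Const 20 5, Load 4 20, Const 20 6,
     Load 5 20, Const 6 8]"

text \<open>The first look-up turns the symbol into its rank, at most \<open>n\<close>; register 4
  holds \<open>n + 1\<close>, so address times \<open>n + 1\<close> plus rank encodes the pair
  injectively.\<close>

definition follow_edge :: prog where
  "follow_edge = seq [Bin Add 9 2 0, Bin Add 13 8 0, lookup, Bin Mul 20 6 4, Bin Add 13 20 13,
     Bin Add 9 3 0, lookup, Bin Add 6 13 0]"

text \<open>The dead state, address 0, needs no test: its stored depth is 0, so an edge is always
  followed, and \<open>child\<close> maps the resulting keys \<open>rank c\<close> to 0
  again.\<close>

definition search_step :: prog where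
  "search_step = seq [Read 8, Load 20 6,
     Cond (Less 7 20)
       (seq [Bin Add 21 6 1, Load 21 21, Bin Add 21 21 7, Load 21 21,
          Cond (Equal 21 8) Skip (Const 6 0)])
       follow_edge,
     Bin Add 7 7 1]"

definition sort_leaves :: prog where
  "sort_leaves = seq [Const 20 2, Bin Add 20 20 6, Load 14 20, Bin Add 20 20 1, Load 18 20,
     Bin Add 20 20 1, Load 17 20, Bin Add 20 20 1, Load 16 20,
     Bin Add 19 5 17, Bin Add 15 19 18, Bin Add 15 15 18, radix_pass,
     Bin Add 14 15 0, Bin Mul 16 16 17, radix_pass]"

definition query :: prog where
  "query = seq [init, While Neof search_step, sort_leaves, emit]"

section \<open>Correctness and running time of the query\<close>

context text_index
begin

text \<open>Register 7 is constrained only while the pattern still occurs: the length of a dead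
  pattern is unbounded, so the counter may wrap around.\<close>

definition searching :: "state \<Rightarrow> nat list \<Rightarrow> bool" where
  "searching s X \<longleftrightarrow> regs s 0 = 0 \<and> regs s 1 = 1 \<and> regs s 2 = d1 \<and> regs s 3 = d2 \<and> regs s 4 = n + 1 \<and>
     regs s 5 = length D \<and> regs s 6 = addr (occurrences T X) \<and>
     (occurrences T X \<noteq> {} \<longrightarrow> regs s 7 = length X) \<and> stored D s \<and> out s = []"

text \<open>The current node is the lower end of the edge where \<open>X\<close> ends. If
  \<open>X\<close> is shorter than the label, \<open>occurrences_snoc_inside\<close> justifies the
  comparison with the text; otherwise \<open>X\<close> is the label by \<open>label_eqI\<close> and
  the dictionary decides.\<close>

lemma wp_search_step:
  assumes s: "searching s X" and inp: "inp s = c # ps" and c: "c < 2 ^ w"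
  shows "wp w search_step (\<lambda>t s'. t < 70 \<and> searching s' (X @ [c]) \<and> inp s' = ps) s"
proof -
  have R: "regs s 0 = 0" "regs s 1 = 1" "regs s 2 = d1" "regs s 3 = d2" "regs s 4 = n + 1"
     "regs s 5 = length D" "regs s 6 = addr (occurrences T X)"
     and R7: "occurrences T X \<noteq> {} \<Longrightarrow> regs s 7 = length X" and st: "stored D s" and out: "out s = []"
    using s by (auto simp: searching_def)
  have mem: "mem s a = D ! a" if "a < length D" for a using st that by (simp add: stored_def)
  define S where "S = occurrences T X"
  \<comment> \<open>Shared by the dead state, where \<open>addr S\<close> is 0, and by the arrival
    at a node.\<close>
  have lookups: "wp w follow_edge (\<lambda>t s'. t \<le> 60 \<and> mem s' = mem s \<and> inp s' = ps \<and> out s' = out s \<and>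
         regs s' 6 = child (addr S * (n + 1) + rank c) \<and> (\<forall>q<6. regs s' q = regs s q) \<and> regs s' 7 = regs s 7)
         (s\<lparr>inp := ps, regs := (regs s)(8 := c, 20 := x)\<rparr>)"
     if key: "addr S * (n + 1) + n < 2 ^ w" and ch: "child (addr S * (n + 1) + rank c) < 2 ^ w" for x
  proof -
    have small: "d1 < 2 ^ w" "d2 < 2 ^ w" using dict1 dict2 D by linarith+
    show ?thesis
      apply (simp add: follow_edge_def R small c flip: S_def)
      apply (rule wp_lookup[OF dict1(1), where a = d1 and key = c])
      using dict1 D c apply (simp_all add: R mem)[7]
      subgoal premises prems for t R'
      proof -
        have kr: "addr S * (n + 1) + rank c < 2 ^ w" using key rank(1)[of c] by linarith
        then have kr': "(addr S * (n + 1)) mod 2 ^ w = addr S * (n + 1)"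
           "(addr S * (n + 1) + rank c) mod 2 ^ w = addr S * (n + 1) + rank c" by auto
        have R'': "R' 0 = 0" "R' 1 = 1" "R' 2 = d1" "R' 3 = d2" "R' 4 = n + 1" "R' 5 = length D"
          "R' 6 = addr S" "R' 7 = regs s 7" "R' 8 = c" "R' 13 = rank c"
          using prems R by (auto simp: S_def)
        show ?thesis
          apply (simp add: R'' kr' small del: mult_Suc_right add_mult_distrib2 distrib_left)
          apply (rule wp_lookup[OF dict2(1), where a = d2 and key = "addr S * (n + 1) + rank c"])
          using dict2 D kr apply (simp_all add: R'' mem)[7]
          using prems R'' ch R by (auto simp: less_Suc_eq numeral_eq_Suc)
      qed
      done
  qed
  have addr_less: "addr S' < 2 ^ w" if "S' \<in> insert {} (nodes T)" for S'
    using leaves[OF that] D by (auto simp: leaves_ok_def)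
  show ?thesis
  proof (cases "S = {}")
    case True
    then have a0: "addr S = 0" using addr by simp
    then have ch0: "child (addr S * (n + 1) + rank c) = 0" using child(2)[OF c] by simp
    have "occurrences T (X @ [c]) = {}"
      using True occurrences_antimono[of X "X @ [c]" T] by (auto simp: S_def)
    then have "searching s' (X @ [c])" if "mem s' = mem s" "out s' = out s"
      "\<forall>q<6. regs s' q = regs s q" "regs s' 6 = 0" for s'
      using that R st out addr by (auto simp: searching_def stored_def)
    moreover have "n < 2 ^ w" using D by simp
    then have "wp w follow_edge (\<lambda>t s'. t \<le> 60 \<and> mem s' = mem s \<and> inp s' = ps \<and> out s' = out s \<and>
         regs s' 6 = 0 \<and> (\<forall>q<6. regs s' q = regs s q) \<and> regs s' 7 = regs s 7)
         (s\<lparr>inp := ps, regs := (regs s)(8 := c, 20 := 0)\<rparr>)"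
      using lookups[of 0, unfolded ch0] by (simp add: a0)
    moreover have "mem s 0 = 0" using mem[of 0] hdr by (cases D) auto
    ultimately show ?thesis
      unfolding search_step_def
      apply (simp add: inp R a0 flip: S_def)
      apply (rule wp_mono, assumption)
      by auto
  next
    case False
    then have SN: "S \<in> nodes T" by (auto simp: nodes_def S_def)
    have len: "regs s 7 = length X" using R7 False by (simp add: S_def)
    have aS: "addr S + 8 \<le> length D" using leaves[of S] SN by (auto simp: leaves_ok_def)
    have dep: "mem s (addr S) = length (label T S)" using mem[of "addr S"] aS depth[OF SN] by simp
    have xn: "length X \<le> n" using length_le_if_occurs False n by (auto simp: S_def)
    have len1: "(length X + 1) mod 2 ^ w = length X + 1" using xn D by simp
    have next_ok: "searching s' (X @ [c])" if "mem s' = mem s" "out s' = out s"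
      "\<forall>q<6. regs s' q = regs s q" "regs s' 6 = addr (occurrences T (X @ [c]))" "regs s' 7 = length X + 1" for s'
      using that R st out by (auto simp: searching_def stored_def)
    show ?thesis
    proof (cases "length X < length (label T S)")
      case True
      obtain k where k: "k \<in> S" "D ! (addr S + 1) = tb + (k - 1)" using witness[OF SN] by blast
      have "k \<in> occurrences T (label T S)" using k SN by (simp add: occurrences_label_node)
      then have "length (label T S) \<le> n - (k - 1)" "1 \<le> k" "k \<le> n"
        using prefix_length_le n by (fastforce simp: occurrences_eq)+
      then have kn: "k - 1 + length X < n" using True by simp
      define a where "a = tb + (k - 1)"
      have m1: "mem s (addr S + 1) = a" using mem[of "addr S + 1"] aS k by (simp add: a_def)
      have m2: "mem s (a + length X) = T ! (k - 1 + length X)"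
        using mem[of "a + length X"] symbols kn by (simp add: a_def add.assoc)
      have mods: "(addr S + 1) mod 2 ^ w = addr S + 1" "(a + length X) mod 2 ^ w = a + length X"
        using aS D symbols kn by (auto simp: a_def)
      have occ: "occurrences T (X @ [c]) = (if T ! (k - 1 + length X) = c then S else {})"
        using k True by (intro occurrences_snoc_inside) (auto simp: S_def)
      show ?thesis unfolding search_step_def
        by (simp add: inp R len dep True mods m1 m2 len1 flip: S_def)
          (intro conjI impI next_ok; use occ addr R in \<open>simp add: S_def\<close>)
    next
      case no: False
      have "length X = length (label T S)"
        using length_label[of S T X] no False by (auto simp: S_def)
      then have lab: "label T S = X" using False by (intro label_eqI) (auto simp: S_def)
      have ch: "child (addr S * (n + 1) + rank c) = addr (occurrences T (X @ [c]))"
        using child(1)[OF SN c] lab by simp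
      have "occurrences T (X @ [c]) \<in> insert {} (nodes T)" by (auto simp: nodes_def)
      then have "wp w follow_edge (\<lambda>t s'. t \<le> 60 \<and> mem s' = mem s \<and> inp s' = ps \<and> out s' = out s \<and>
         regs s' 6 = addr (occurrences T (X @ [c])) \<and> (\<forall>q<6. regs s' q = regs s q) \<and> regs s' 7 = regs s 7)
         (s\<lparr>inp := ps, regs := (regs s)(8 := c, 20 := length (label T S))\<rparr>)"
        unfolding ch[symmetric] by (intro lookups) (use rank(2)[OF SN] addr_less ch in auto)
      then show ?thesis
        unfolding search_step_def
        apply (simp add: inp R len dep no flip: S_def)
        apply (rule wp_mono, assumption)
        using R(1,2) len1 len by (auto intro!: next_ok)
    qed
  qed
qed

lemma wp_search:
  assumes s: "searching s []" and P: "inp s = P" "P \<in> words w"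
  shows "wp w (While Neof search_step) (\<lambda>t s'. t \<le> 70 * length P + 1 \<and> searching s' P) s"
proof -
  define I where "I k s' \<longleftrightarrow> (\<exists>X. searching s' X \<and> P = X @ inp s' \<and> k = length (inp s'))" for k s'
  have "wp w (While Neof search_step)
    (\<lambda>t s'. t \<le> 70 * length P + 1 \<and> \<not> holds Neof s' \<and> (\<exists>k. I k s')) s"
  proof (rule wp_While)
    show "I (length P) s" using s P by (auto simp: I_def)
  next
    fix k s' assume "I k s'" "holds Neof s'"
    then obtain X c ps where *: "searching s' X" "P = X @ inp s'" "inp s' = c # ps" "k = length (inp s')"
      by (auto simp: I_def neq_Nil_conv)
    have "c < 2 ^ w" using P * by (auto simp: words_def)
    from wp_search_step[OF *(1,3) this]
    show "wp w search_step (\<lambda>t s'. t < 70 \<and> (\<exists>k'<k. I k' s')) s'"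
      by (rule wp_mono) (use * in \<open>auto simp: I_def\<close>)
  qed
  then show ?thesis by (rule wp_mono) (auto simp: I_def)
qed

lemma wp_sort_leaves:
  assumes s: "searching s P" and S: "S = occurrences T P"
  shows "wp w sort_leaves (\<lambda>t s'. t \<le> 80 * card S + 80 \<and> stored D s' \<and> out s' = [] \<and>
    regs s' 0 = 0 \<and> regs s' 1 = 1 \<and> regs s' 4 = n + 1 \<and> regs s' 18 = card S \<and>
    regs s' 15 + card S < 2 ^ w \<and>
    (\<exists>zs. map (\<lambda>x. x mod (n + 1)) zs = sorted_list_of_set S \<and> length zs = card S \<and>
      (\<forall>i<card S. mem s' (regs s' 15 + i) = zs ! i))) s"
proof -
  define a where "a = addr S"
  have R: "regs s 0 = 0" "regs s 1 = 1" "regs s 4 = n + 1" "regs s 5 = length D" "regs s 6 = a"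
    and st: "stored D s" and out: "out s = []"
    using s by (auto simp: searching_def a_def S)
  have mem: "mem s a = D ! a" if "a < length D" for a using st that by (simp add: stored_def)
  have "S \<in> insert {} (nodes T)" by (auto simp: S nodes_def)
  then obtain xs b p src where xs: "length xs = card S" and a: "a + 8 \<le> length D"
    and f: "D ! (a + 2) = src" "D ! (a + 3) = card S" "D ! (a + 4) = b" "D ! (a + 5) = p"
    and src: "src + card S \<le> length D" "\<And>i. i < card S \<Longrightarrow> D ! (src + i) = xs ! i"
    and b: "b \<le> card S + 1" "xs \<noteq> [] \<Longrightarrow> 0 < b" and pb: "p * b < 2 ^ w"
    and srt: "map (\<lambda>x. x mod (n + 1)) (bucket_pass (\<lambda>x. x div (p * b) mod b) b (bucket_pass (\<lambda>x. x div p mod b) b xs))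
       = sorted_list_of_set S"
    using leaves[of S] unfolding leaves_ok_def a_def by blast
  have "card S \<le> card {1..n}" unfolding S n by (intro card_mono occurrences_subset) simp
  then have Sn: "card S \<le> n" by simp
  define Z where "Z = length D"
  have Zb: "Z + b + 3 * card S < 2 ^ w" using D b Sn by (simp add: Z_def)
  have mods: "2 mod 2 ^ w = (2::nat)" "(3 + a) mod 2 ^ w = a + 3" "(4 + a) mod 2 ^ w = a + 4"
    "(5 + a) mod 2 ^ w = a + 5" "(2 + a) mod 2 ^ w = a + 2" "(a + 2 + 1) mod 2 ^ w = a + 3"
    "(a + 3 + 1) mod 2 ^ w = a + 4" "(a + 4 + 1) mod 2 ^ w = a + 5" "(Z + b) mod 2 ^ w = Z + b"
    "(Z + b + card S) mod 2 ^ w = Z + b + card S"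
    "(Z + b + card S + card S) mod 2 ^ w = Z + b + 2 * card S"
    "(Z + b + 2 * card S) mod 2 ^ w = Z + b + 2 * card S" "(p * b) mod 2 ^ w = p * b"
    using D a Zb pb by auto
  have m: "mem s (a + 2) = src" "mem s (a + 3) = card S" "mem s (a + 4) = b" "mem s (a + 5) = p"
    using mem a f by auto
  define g where "g p x = x div p mod b" for p x
  define ys where "ys = bucket_pass (g p) b xs"
  define zs where "zs = bucket_pass (g (p * b)) b ys"
  have gb: "g q x < b" if "0 < card S" for q x using b(2) that xs by (cases xs) (auto simp: g_def)
  have ly: "length ys = card S" unfolding ys_def xs[symmetric]
    by (rule length_bucket_pass, rule gb) (metis length_pos_if_in_set xs)
  have "length zs = length ys" unfolding zs_def
    by (rule length_bucket_pass, rule gb) (metis length_pos_if_in_set ly)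
  then have lz: "length zs = card S" using ly by simp
  have zs: "map (\<lambda>x. x mod (n + 1)) zs = sorted_list_of_set S"
    using srt by (simp add: zs_def ys_def g_def[abs_def])
  have Z: "0 < Z" unfolding Z_def using hdr(1) by linarith
  have second: "wp w (seq [Bin Add 14 15 0, Bin Mul 16 16 17, radix_pass])
      (\<lambda>t s'. t \<le> 40 * card S + 32 \<and> (\<forall>a<Z. mem s' a = mem s1 a) \<and> out s' = [] \<and>
        (\<forall>q\<in>{0, 1, 4, 15, 18}. regs s' q = regs s1 q) \<and>
        (\<forall>i<card S. mem s' (Z + b + 2 * card S + i) = zs ! i)) s1"
    if out1: "out s1 = []"
      and R1: "regs s1 0 = 0" "regs s1 1 = 1" "regs s1 5 = Z" "regs s1 15 = Z + b + 2 * card S"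
        "regs s1 16 = p" "regs s1 17 = b" "regs s1 18 = card S" "regs s1 19 = Z + b"
      and ys: "\<And>i. i < card S \<Longrightarrow> mem s1 (Z + b + 2 * card S + i) = ys ! i" for s1
    apply (simp add: R1 mods)
    apply (rule wp_radix_pass[where Z = Z and b = b and p = "p * b" and xs = ys and src = "Z + b + 2 * card S"])
    subgoal by (simp add: R1)
    subgoal by (simp add: R1)
    subgoal by (simp add: R1)
    subgoal by simp
    subgoal by (simp add: R1 ly)
    subgoal by simp
    subgoal by (simp add: R1)
    subgoal by (simp add: R1 ly)
    subgoal by (simp add: R1)
    subgoal using Z by simp
    subgoal using Zb ly by simp
    subgoal using Zb ly by simp
    subgoal using b(2) ly xs by (cases xs) auto
    subgoal using ys ly by simp
    subgoal using ly by simp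
    subgoal premises prems for t s'
      using prems b(1) out1 same_upto_simps[OF prems(2)] unfolding same_upto_def
      by (simp add: R1 ly zs_def g_def[abs_def])
    done
  have "wp w radix_pass (\<lambda>t. wp w (Seq (Bin Add 14 15 0) (Seq (Bin Mul 16 16 17) radix_pass))
      (\<lambda>u s'. t + u \<le> 80 * card S + 62 \<and> stored D s' \<and> out s' = [] \<and>
    regs s' 0 = 0 \<and> regs s' 1 = 1 \<and> regs s' 4 = n + 1 \<and> regs s' 18 = card S \<and>
    regs s' 15 + card S < 2 ^ w \<and>
    (\<exists>zs. map (\<lambda>x. x mod (n + 1)) zs = sorted_list_of_set S \<and> length zs = card S \<and>
      (\<forall>i<card S. mem s' (regs s' 15 + i) = zs ! i)))) s0"
    if s0: "regs s0 0 = 0" "regs s0 1 = 1" "regs s0 4 = n + 1" "regs s0 5 = Z" "regs s0 14 = src"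
      "regs s0 15 = Z + b + 2 * card S" "regs s0 16 = p" "regs s0 17 = b" "regs s0 18 = card S"
      "regs s0 19 = Z + b" and ms: "mem s0 = mem s" "out s0 = []" for s0
  proof (rule wp_radix_pass[where Z = Z and b = b and p = p and xs = xs and src = src])
    show "mem s0 (src + i) = xs ! i" "src + i \<notin> {Z..<Z + b + 2 * length xs}" if "i < length xs" for i
      using that src mem ms xs by (auto simp: Z_def)
    fix t s1
    assume 1: "t \<le> 20 * (b + length xs) + 10" "same_upto s0 s1 {Z..<Z + b + 3 * length xs}" "out s1 = out s0"
      "\<And>i. i < length xs \<Longrightarrow> mem s1 (Z + b + 2 * length xs + i) = bucket_pass (\<lambda>x. x div p mod b) b xs ! i"
    note r1 = same_upto_simps[OF 1(2)]
    from second[of s1] have 2: "wp w (seq [Bin Add 14 15 0, Bin Mul 16 16 17, radix_pass])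
      (\<lambda>t s'. t \<le> 40 * card S + 32 \<and> (\<forall>a<Z. mem s' a = mem s1 a) \<and> out s' = [] \<and>
        (\<forall>q\<in>{0, 1, 4, 15, 18}. regs s' q = regs s1 q) \<and>
        (\<forall>i<card S. mem s' (Z + b + 2 * card S + i) = zs ! i)) s1"
      using r1 1 s0 ms xs by (auto simp: ys_def g_def[abs_def])
    have R1: "regs s1 0 = 0" "regs s1 1 = 1" "regs s1 4 = n + 1" "regs s1 15 = Z + b + 2 * card S"
      "regs s1 18 = card S" using r1 s0 by auto
    have m1: "mem s1 i = D ! i" if "i < length D" for i
      using that r1(3)[of i] ms mem by (simp add: Z_def)
    show "wp w (Seq (Bin Add 14 15 0) (Seq (Bin Mul 16 16 17) radix_pass))
      (\<lambda>u s'. t + u \<le> 80 * card S + 62 \<and> stored D s' \<and> out s' = [] \<and>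
    regs s' 0 = 0 \<and> regs s' 1 = 1 \<and> regs s' 4 = n + 1 \<and> regs s' 18 = card S \<and>
    regs s' 15 + card S < 2 ^ w \<and>
    (\<exists>zs. map (\<lambda>x. x mod (n + 1)) zs = sorted_list_of_set S \<and> length zs = card S \<and>
      (\<forall>i<card S. mem s' (regs s' 15 + i) = zs ! i))) s1"
    proof (rule wp_mono[OF 2[unfolded seq.simps]])
      fix u :: nat and s' :: state
      assume *: "u \<le> 40 * card S + 32 \<and> (\<forall>a<Z. mem s' a = mem s1 a) \<and> out s' = [] \<and>
        (\<forall>q\<in>{0, 1, 4, 15, 18}. regs s' q = regs s1 q) \<and>
        (\<forall>i<card S. mem s' (Z + b + 2 * card S + i) = zs ! i)"
      then have "stored D s'" using m1 by (auto simp: stored_def same_upto_def Z_def)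
      moreover have "t + u \<le> 80 * card S + 62" using * 1(1) b(1) xs by simp
      ultimately show "t + u \<le> 80 * card S + 62 \<and> stored D s' \<and> out s' = [] \<and>
        regs s' 0 = 0 \<and> regs s' 1 = 1 \<and> regs s' 4 = n + 1 \<and> regs s' 18 = card S \<and>
        regs s' 15 + card S < 2 ^ w \<and>
        (\<exists>zs. map (\<lambda>x. x mod (n + 1)) zs = sorted_list_of_set S \<and> length zs = card S \<and>
          (\<forall>i<card S. mem s' (regs s' 15 + i) = zs ! i))"
        using * R1 Zb zs lz by auto
    qed
  qed (use s0 xs Z Zb src b D in \<open>auto simp: Z_def\<close>)
  note first = this
  show ?thesis unfolding sort_leaves_def
    apply (simp add: R mods m flip: Z_def)
    apply (rule wp_mono[OF first])
    using R out apply (simp_all flip: Z_def)[12]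
    apply (rule wp_mono, assumption)
    by auto
qed

lemma answers_query:
  assumes P: "P \<in> words w"
  shows "answers_within w query D P (sorted_list_of_set (occurrences T P))
    (100 * length P + 100 * card (occurrences T P) + 200)"
  unfolding answers_within_def
proof (intro allI impI)
  fix s assume s: "query_state w D P s"
  define S where "S = occurrences T P"
  have st: "stored D s" using s by (simp add: query_state_def)
  have mem: "mem s a = D ! a" if "a < length D" for a using st that by (simp add: stored_def)
  have m: "mem s 1 = d1" "mem s 2 = d2" "mem s 5 = n + 1" "mem s 6 = length D"
    using mem hdr by auto
  have w: "8 mod 2 ^ w = (8::nat)" "1 mod 2 ^ w = (1::nat)" "2 mod 2 ^ w = (2::nat)"
    "5 mod 2 ^ w = (5::nat)" "6 mod 2 ^ w = (6::nat)"
    using D hdr(1) by (intro mod_less; linarith)+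
  have "wp w init (\<lambda>t s'. t = 9 \<and> searching s' [] \<and> inp s' = P) s"
    using s m w addr by (simp add: init_def query_state_def searching_def) (simp add: stored_def)
  then have "wp w (seq [init, While Neof search_step]) (\<lambda>t s'. t \<le> 70 * length P + 10 \<and> searching s' P) s"
    apply simp
    apply (rule wp_mono, assumption)
    apply clarify
    apply (rule wp_mono[OF wp_search])
    using P by auto
  then have "wp w query (\<lambda>t s'. t \<le> 100 * length P + 100 * card S + 200 \<and> stored D s' \<and>
    out s' = sorted_list_of_set S) s"
    apply (simp add: query_def)
    apply (rule wp_mono, assumption)
    apply simp
    apply (rule wp_mono, assumption)
    apply simp
    apply (elim conjE)
    apply (rule wp_mono[OF wp_sort_leaves[OF _ S_def]], assumption)
    subgoal premises prems for t1 s1 t2 s2 t3 s3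
    proof -
      obtain zs where zs: "map (\<lambda>x. x mod (n + 1)) zs = sorted_list_of_set S" "length zs = card S"
        "\<And>i. i < card S \<Longrightarrow> mem s3 (regs s3 15 + i) = zs ! i" using prems by blast
      show ?thesis
        apply (rule wp_emit[where a = "regs s3 15" and xs = zs and r = "n + 1"])
        using prems zs apply simp_all[7]
        using prems zs by (auto simp: stored_def same_upto_def)
    qed
    done
  then show "\<exists>t s'. exec w query s t s' \<and>
    t \<le> 100 * length P + 100 * card (occurrences T P) + 200 \<and>
    out s' = sorted_list_of_set (occurrences T P) \<and> stored D s'"
    unfolding wp_def S_def by blast
qed

end

section \<open>The data structure\<close>

text \<open>The fields of all levels needed take up \<open>O(log n)\<close> bits, since their widths double.\<close>

definition leaf_entry :: "nat list \<Rightarrow> nat \<Rightarrow> nat" where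
  "leaf_entry T k = pack (\<lambda>j. cluster_rank (nodes T) (level_bound j) k) (level (length T) + 2) *
     (length T + 1) + k"

lemma cluster_rank_nodes_less: "cluster_rank (nodes T) (level_bound j) k < level_bound j"
proof (rule cluster_rank_less)
  show "finite S" if "S \<in> nodes T" for S using that by (auto simp: nodes_def)
qed (simp_all add: laminar_nodes)

text \<open>Two levels up means a fourth power: \<open>level_bound (level n + 2)\<close> is that of
  \<open>level_bound (level n)\<close>, which is at most \<open>n + 1\<close>. The position
  contributes the fifth factor.\<close>

lemma leaf_entry_less:
  assumes "k \<le> length T" "T \<noteq> []"
  shows "leaf_entry T k < (length T + 1) ^ 5"
proof -
  let ?n = "length T"
  let ?x = "pack (\<lambda>j. cluster_rank (nodes T) (level_bound j) k) (level ?n + 2)"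
  have "?x < level_bound (level ?n + 2)" by (intro pack_less cluster_rank_nodes_less)
  also have "level_bound (level ?n + 2) = level_bound (level ?n) ^ 4"
    by (simp add: level_bound_Suc numeral_eq_Suc One_nat_def)
  also have "\<dots> \<le> (?n + 1) ^ 4"
    using assms by (intro power_mono level_bound_level) auto
  finally have "(?x + 1) * (?n + 1) \<le> (?n + 1) ^ 4 * (?n + 1)" by (intro mult_right_mono) auto
  also have "(?n + 1) ^ 4 * (?n + 1) = (?n + 1) ^ Suc 4" by (rule power_Suc2[symmetric])
  also have "Suc 4 = 5" by simp
  finally have "?x * (?n + 1) + (?n + 1) \<le> (?n + 1) ^ 5" by (simp add: algebra_simps)
  moreover have "leaf_entry T k < ?x * (?n + 1) + (?n + 1)" using assms by (simp add: leaf_entry_def)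
  ultimately show ?thesis by linarith
qed

lemma leaf_entry_mod: "k \<le> length T \<Longrightarrow> leaf_entry T k mod (length T + 1) = k"
  by (simp add: leaf_entry_def)

text \<open>Division by \<open>length T + 1\<close> strips the position, division by
  \<open>b * b\<close> the fields below level \<open>Suc (level (card S))\<close>. That field has
  range \<open>b * b\<close> as well, so the digits extracted with \<open>p\<close> and
  \<open>p * b\<close> are those of the rank, and ranks increase with positions inside
  \<open>S\<close>.\<close>

lemma sort_leaf_entries:
  assumes S: "S \<in> nodes T" and ks: "set ks = S" "distinct ks"
    and b: "b = level_bound (level (card S))" and p: "p = (length T + 1) * (b * b)"
  shows "map (\<lambda>x. x mod (length T + 1)) (bucket_pass (\<lambda>x. x div (p * b) mod b) b
     (bucket_pass (\<lambda>x. x div p mod b) b (map (leaf_entry T) ks))) = sorted_list_of_set S"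
proof -
  let ?n = "length T" and ?v = "\<lambda>x. x mod (length T + 1)"
  define r where "r k = cluster_rank (nodes T) (level_bound (Suc (level (card S)))) k" for k
  have S_sub: "S \<subseteq> {1..?n}" using S nodes_subset by blast
  have b0: "0 < b" by (simp add: b)
  have A: "level_bound (Suc (level (card S))) = b * b" by (simp add: b level_bound_Suc)
  have "card S \<le> ?n" using S_sub card_mono[OF _ S_sub] by simp
  \<comment> \<open>The highest level ever consulted is \<open>Suc (level ?n)\<close>; hence the
    \<open>+ 2\<close> in \<open>leaf_entry\<close>.\<close>
  then have lev: "Suc (level (card S)) < level ?n + 2" using level_mono[of "card S" ?n] by simp
  have dig: "leaf_entry T k div p mod b = r k mod b" "leaf_entry T k div (p * b) mod b = r k div b"
    if k: "k \<in> S" for k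
  proof -
    define x where "x = pack (\<lambda>j. cluster_rank (nodes T) (level_bound j) k) (level ?n + 2)"
    have "leaf_entry T k div (?n + 1) = x" using k S_sub by (auto simp: leaf_entry_def x_def)
    then have d: "leaf_entry T k div p = x div (b * b)" by (simp only: p div_mult2_eq)
    have r: "x div (b * b) mod (b * b) = r k"
      unfolding A[symmetric] x_def r_def by (rule pack_field[OF cluster_rank_nodes_less lev])
    show "leaf_entry T k div p mod b = r k mod b"
      unfolding d r[symmetric] by (simp add: mod_mod_cancel)
    have "r k = b * (x div (b * b) div b mod b) + x div (b * b) mod b"
      unfolding r[symmetric] by (rule mod_mult2_eq)
    then have "r k div b = x div (b * b) div b mod b" using b0 by simp
    then show "leaf_entry T k div (p * b) mod b = r k div b" by (simp only: div_mult2_eq d)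
  qed
  have v: "?v (leaf_entry T k) = k" if "k \<in> S" for k
    using that S_sub by (intro leaf_entry_mod) auto
  have img: "?v ` set (map (leaf_entry T) ks) = S" using ks v by (simp add: image_image)
  have inj: "inj_on (leaf_entry T) S" using v by (intro inj_on_inverseI[where g = ?v])
  define lo hi where "lo x = x div p mod b" and "hi x = x div (p * b) mod b" for x
  define es where "es = map (leaf_entry T) ks"
  have "map ?v (bucket_pass hi b (bucket_pass lo b es)) = sorted_list_of_set (?v ` set es)"
  proof (rule radix_sort)
    show "distinct es" using ks inj by (simp add: distinct_map es_def)
    show "inj_on ?v (set es)" using ks v by (auto simp: inj_on_def es_def)
    show "lo x < b" "hi x < b" for x using b0 by (simp_all add: lo_def hi_def)
    fix x y assume xy: "x \<in> set es" "y \<in> set es" "?v x < ?v y"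
    then obtain k k' where k: "x = leaf_entry T k" "y = leaf_entry T k'" "k \<in> S" "k' \<in> S"
      using ks by (auto simp: es_def)
    then have "k < k'" using xy v by simp
    then have "r k < r k'" unfolding r_def
      using k S level by (intro cluster_rank_strict_mono[OF laminar_nodes S]) auto
    then show "hi x * b + lo x < hi y * b + lo y"
      using k by (simp add: dig lo_def hi_def)
  qed
  then show ?thesis using img by (simp add: lo_def[abs_def] hi_def[abs_def] es_def)
qed

lemma exists_index_map:
  assumes "distinct xs"
  shows "\<exists>f. \<forall>i<length xs. f (xs ! i) = i"
proof (intro exI allI impI)
  fix i assume "i < length xs"
  then show "the_inv_into {..<length xs} ((!) xs) (xs ! i) = i"
    using assms by (intro the_inv_into_f_f inj_on_nth) auto
qed

lemma exists_text_index:
  assumes T: "T \<noteq> []" "T \<in> words w" and w: "2 ^ 20 * (length T + 1) ^ 8 \<le> (2::nat) ^ w"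
  shows "\<exists>D addr rank child tb d1 d2 B1 B2.
    text_index w T D addr rank child (length T) tb d1 d2 B1 B2 \<and> length D \<le> 310 * length T"
proof -
  define n where "n = length T"
  define N where "N = n + 1"
  have n0: "0 < n" using T by (simp add: n_def)
  have N2: "2 \<le> N" using n0 by (simp add: N_def)
  \<comment> \<open>One generous hypothesis serves all word-size bounds below, whose coefficients
    are at most 400 and exponents at most 5.\<close>
  have small: "k * N ^ i < 2 ^ w" if "k < 2 ^ 20" "i \<le> 8" for k i
  proof -
    have "k * N ^ i < 2 ^ 20 * N ^ i" using that N2 by (intro mult_strict_right_mono) auto
    also have "\<dots> \<le> 2 ^ 20 * N ^ 8" using that N2 by (intro mult_left_mono power_increasing) auto
    finally show ?thesis using w by (simp add: N_def n_def)
  qed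
  define root where "root = occurrences T []"
  have root: "root \<in> nodes T" "root \<noteq> {}"
  proof -
    have "1 \<in> root" using n0 by (simp add: root_def occurrences_eq n_def One_nat_def Suc_le_eq)
    then show "root \<noteq> {}" by blast
    then show "root \<in> nodes T" by (auto simp: root_def nodes_def)
  qed
  obtain Fs where Fs: "set Fs = nodes T - {root}" "distinct Fs"
    using finite_distinct_list[of "nodes T - {root}"] by auto
  \<comment> \<open>The order matters: it gives the empty set address 0 and the root address 8,
    where the query starts.\<close>
  define Gs where "Gs = {} # root # Fs"
  have ne: "{} \<notin> nodes T" by (auto simp: nodes_def)
  have Gs: "distinct Gs" "set Gs = insert {} (nodes T)" using Fs root ne by (auto simp: Gs_def)
  define g where "g = length Gs"
  have "g = card (insert {} (nodes T))" using Gs by (metis distinct_card g_def)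
  also have "\<dots> = card (nodes T) + 1" using ne by (simp add: One_nat_def)
  finally have g: "g \<le> 2 * n + 1" using card_nodes[of T] by (simp add: n_def)
  obtain ix where ix: "\<And>i. i < g \<Longrightarrow> ix (Gs ! i) = i" using exists_index_map[OF Gs(1)] by (auto simp: g_def)
  define addr where "addr S = 8 * ix S" for S
  have ixS: "ix S < g" "Gs ! ix S = S" if "S \<in> insert {} (nodes T)" for S
    using that ix Gs(2) by (metis g_def in_set_conv_nth)+
  have addr0: "addr {} = 0" using ix[of 0] by (simp add: addr_def Gs_def g_def)
  have addr1: "addr root = 8" using ix[of 1] by (simp add: addr_def Gs_def g_def One_nat_def)
  have addr_inj: "S = S'" if "addr S = addr S'" "S \<in> nodes T" "S' \<in> nodes T" for S S'
    using that ixS by (metis addr_def insertCI mult_cancel1 zero_neq_numeral)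
  have addr_ge: "8 \<le> addr S" if "S \<in> nodes T" for S
  proof -
    have "Gs ! ix S \<noteq> Gs ! 0" using that ixS[of S] ne by (auto simp: Gs_def)
    then have "1 \<le> ix S" by (cases "ix S") auto
    then show ?thesis by (simp add: addr_def)
  qed
  have addr_less: "addr S + 8 \<le> 8 * g" if "S \<in> insert {} (nodes T)" for S
    using ixS[OF that] by (simp add: addr_def)
  obtain h where h: "bij_betw h (set T) {0..<card (set T)}" using ex_bij_betw_finite_nat[OF finite_set] ..
  \<comment> \<open>Ranks of symbols of \<open>T\<close> start at 1, so foreign symbols, of rank 0,
    never form the key of an edge.\<close>
  define rank where "rank c = (if c \<in> set T then h c + 1 else 0)" for c
  have cT: "card (set T) \<le> n" by (simp add: n_def card_length)
  have "h c < card (set T)" if "c \<in> set T" for c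
    using bij_betwE[OF h] that by simp
  then have rank_le: "rank c \<le> n" for c
    using cT by (fastforce simp: rank_def One_nat_def Suc_le_eq)
  have rank_inj: "c = c'" if "rank c = rank c'" "c \<in> set T" for c c'
    using that inj_onD[OF bij_betw_imp_inj_on[OF h]] by (auto simp: rank_def split: if_splits)
  have sup1: "{c. rank c \<noteq> 0} = set T" by (auto simp: rank_def)
  have "\<exists>B \<in> words w. length B \<le> 90 * n + 7 \<and> is_dict w B rank"
  proof (rule exists_dict)
    show "rank x < 2 ^ w" for x using small[of 1 1] rank_le[of x] by (simp add: N_def)
    show "x < 2 ^ w" if "rank x \<noteq> 0" for x using that T by (auto simp: rank_def words_def split: if_splits)
    have "8 * n\<^sup>2 + 90 * n + 7 \<le> 200 * N ^ 2" by (simp add: N_def power2_eq_square algebra_simps)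
    then show "8 * n\<^sup>2 + 90 * n + 7 < 2 ^ w" using small[of 200 2] by simp
  qed (use sup1 cT in auto)
  then obtain B1 where B1: "B1 \<in> words w" "length B1 \<le> 90 * n + 7" "is_dict w B1 rank" by blast
  define enc where "enc = (\<lambda>(S, c). addr S * (n + 1) + rank c)"
  have enc_eqD: "addr S = addr S' \<and> rank c = rank c'" if "addr S * (n + 1) + rank c = addr S' * (n + 1) + rank c'" for S S' c c'
  proof
    have "(addr S * (n + 1) + rank c) div (n + 1) = addr S" "(addr S' * (n + 1) + rank c') div (n + 1) = addr S'"
      using rank_le[of c] rank_le[of c'] by simp_all
    then show "addr S = addr S'" using that by metis
    then show "rank c = rank c'" using that by simp
  qed
  have enc_inj: "inj_on enc (edges T)"
  proof (rule inj_onI, clarify)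
    fix S c S' c' assume "(S, c) \<in> edges T" "(S', c') \<in> edges T" "enc (S, c) = enc (S', c')"
    then show "S = S' \<and> c = c'"
      using enc_eqD[of S c S' c'] addr_inj rank_inj edge_symbol[of S c T] by (auto simp: enc_def edges_def)
  qed
  define target where "target = (\<lambda>(S, c). occurrences T (label T S @ [c]))"
  define child where "child x = (if x \<in> enc ` edges T then addr (target (the_inv_into (edges T) enc x)) else 0)" for x
  have child_enc: "child (enc e) = addr (target e)" if "e \<in> edges T" for e
    using that enc_inj by (simp add: child_def the_inv_into_f_f)
  have child_node: "child (addr S * (n + 1) + rank c) = addr (occurrences T (label T S @ [c]))"
    if S: "S \<in> nodes T" for S c
  proof (cases "(S, c) \<in> edges T")
    case True
    then show ?thesis using child_enc[OF True] by (simp add: enc_def target_def)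
  next
    case False
    have "addr S * (n + 1) + rank c \<notin> enc ` edges T"
    proof
      assume "addr S * (n + 1) + rank c \<in> enc ` edges T"
      then obtain S' c' where e: "(S', c') \<in> edges T" "addr S * (n + 1) + rank c = addr S' * (n + 1) + rank c'"
        by (auto simp: enc_def)
      then have "S = S'" "c' = c"
        using enc_eqD[OF e(2)] addr_inj S rank_inj[of c' c] edge_symbol[OF e(1)] by (auto simp: edges_def)
      then show False using e False by simp
    qed
    moreover have "occurrences T (label T S @ [c]) = {}" using False S by (simp add: edges_def)
    ultimately show ?thesis by (simp add: child_def addr0)
  qed
  \<comment> \<open>Nodes have addresses of at least 8, so no edge has a key below
    \<open>n + 1\<close>.\<close>
  have child_dead: "child (rank c) = 0" for c
  proof -
    have "rank c \<noteq> enc e" if "e \<in> edges T" for e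
    proof -
      obtain S c' where e: "e = (S, c')" "S \<in> nodes T"
        using \<open>e \<in> edges T\<close> by (auto simp: edges_def)
      have "rank c < 1 * (n + 1)" using rank_le[of c] by simp
      also have "\<dots> \<le> addr S * (n + 1)" using addr_ge[OF e(2)] by (intro mult_right_mono) auto
      finally have "rank c < addr S * (n + 1)" .
      then show ?thesis by (simp add: e enc_def)
    qed
    then show ?thesis by (auto simp: child_def)
  qed
  have addr_w: "addr S * (n + 1) + n < 2 ^ w" if "S \<in> nodes T" for S
  proof -
    have "addr S + 1 \<le> 8 * (2 * n + 1)" using addr_less[of S] that g by simp
    also have "\<dots> \<le> 16 * N" by (simp add: N_def)
    finally have "(addr S + 1) * N \<le> 16 * N * N" by (intro mult_right_mono) auto
    also have "\<dots> = 16 * N ^ 2" by (simp add: power2_eq_square)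
    also have "\<dots> < 2 ^ w" by (rule small) auto
    finally have "(addr S + 1) * N < 2 ^ w" .
    moreover have "addr S * (n + 1) + n \<le> (addr S + 1) * N" by (simp add: N_def algebra_simps)
    ultimately show ?thesis by (rule le_less_trans[rotated])
  qed
  have target: "target e \<in> nodes T" if "e \<in> edges T" for e
    using that by (auto simp: target_def edges_def nodes_def)
  have sup2: "{x. child x \<noteq> 0} \<subseteq> enc ` edges T" by (auto simp: child_def)
  have fin2: "finite (enc ` edges T)" using finite_edges by blast
  have "\<exists>B \<in> words w. length B \<le> 90 * (2 * n) + 7 \<and> is_dict w B child"
  proof (rule exists_dict)
    show "finite {x. child x \<noteq> 0}" using sup2 fin2 by (rule finite_subset)
    have "card {x. child x \<noteq> 0} \<le> card (enc ` edges T)" using sup2 fin2 by (intro card_mono)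
    also have "\<dots> \<le> card (edges T)" using finite_edges by (rule card_image_le)
    finally show "card {x. child x \<noteq> 0} \<le> 2 * n" using card_edges[of T] by (simp add: n_def)
    show "child x < 2 ^ w" for x
    proof (cases "x \<in> enc ` edges T")
      case True
      then obtain e where e: "e \<in> edges T" "x = enc e" by blast
      have "addr (target e) \<le> addr (target e) * (n + 1) + n" by (simp add: algebra_simps)
      also have "\<dots> < 2 ^ w" using addr_w[OF target[OF e(1)]] .
      finally show ?thesis using child_enc[OF e(1)] e by simp
    qed (simp add: child_def)
    show "x < 2 ^ w" if x: "child x \<noteq> 0" for x
    proof -
      obtain S c where e: "(S, c) \<in> edges T" "x = enc (S, c)" using sup2 x by auto
      have "x \<le> addr S * (n + 1) + n" using e rank_le[of c] by (simp add: enc_def)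
      also have "\<dots> < 2 ^ w" using e by (intro addr_w) (auto simp: edges_def)
      finally show ?thesis .
    qed
    have "8 * (2 * n)\<^sup>2 + 90 * (2 * n) + 7 \<le> 300 * N ^ 2" by (simp add: N_def power2_eq_square algebra_simps)
    then show "8 * (2 * n)\<^sup>2 + 90 * (2 * n) + 7 < 2 ^ w" using small[of 300 2] by simp
  qed
  then obtain B2 where B2: "B2 \<in> words w" "length B2 \<le> 180 * n + 7" "is_dict w B2 child" by auto
  define tb where "tb = 8 * g"
  define la where "la = tb + n"
  define d1 where "d1 = la + n"
  define d2 where "d2 = d1 + length B1"
  define Z where "Z = d2 + length B2"
  \<comment> \<open>Records take at most \<open>16 * n + 8\<close> words, text and leaf entries
    \<open>2 * n\<close>, dictionaries \<open>270 * n + 14\<close>; since \<open>0 < n\<close>, the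
    sum \<open>288 * n + 22\<close> is at most \<open>310 * n\<close>.\<close>
  have Z: "Z \<le> 310 * n"
    using g B1 B2 n0 by (simp add: Z_def d2_def d1_def la_def tb_def)
  have Zw: "Z + 4 * (n + 1) < 2 ^ w"
    using Z small[of 400 1] by (simp add: N_def)
  define start where "start S = (SOME l. l + card S \<le> n \<and> set (take (card S) (drop l (suffix_array T))) = S)" for S
  have start: "start S + card S \<le> n" "set (take (card S) (drop (start S) (suffix_array T))) = S" if "S \<in> nodes T" for S
  proof -
    obtain P where "S = occurrences T P" "S \<noteq> {}" using \<open>S \<in> nodes T\<close> by (auto simp: nodes_def)
    then have "\<exists>l. l + card S \<le> n \<and> set (take (card S) (drop l (suffix_array T))) = S"
      unfolding n_def by (rule node_interval)
    from someI_ex[OF this] show "start S + card S \<le> n" "set (take (card S) (drop (start S) (suffix_array T))) = S"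
      by (auto simp: start_def)
  qed
  define base where "base S = level_bound (level (card S))" for S :: "nat set"
  define field where "field S = (if S = {} then [0, d1, d2, 0, 0, n + 1, Z, 0]
     else [length (label T S), tb + (Min S - 1), la + start S, card S, base S, (n + 1) * (base S * base S), 0, 0])" for S
  define D where "D = map (\<lambda>a. field (Gs ! (a div 8)) ! (a mod 8)) [0..<8 * g] @ T @
    map (leaf_entry T) (suffix_array T) @ B1 @ B2"
  have lenD: "length D = Z" by (simp add: D_def Z_def d2_def d1_def la_def tb_def n_def)
  have D_rec: "D ! (addr S + j) = field S ! j" if "S \<in> insert {} (nodes T)" "j < 8" for S j
  proof -
    have "8 * ix S + j < 8 * g" using ixS[OF that(1)] that(2) by simp
    moreover have "(8 * ix S + j) div 8 = ix S" "(8 * ix S + j) mod 8 = j" using that(2) by auto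
    ultimately show ?thesis using ixS[OF that(1)] by (simp add: D_def addr_def nth_append)
  qed
  have D_T: "D ! (tb + i) = T ! i" if "i < n" for i
    using that by (simp add: D_def tb_def nth_append n_def)
  have D_leaf: "D ! (la + i) = leaf_entry T (suffix_array T ! i)" if "i < n" for i
    using that by (simp add: D_def tb_def la_def nth_append n_def)
  have D_B1: "D ! (d1 + i) = B1 ! i" if "i < length B1" for i
    using that by (simp add: D_def tb_def la_def d1_def nth_append n_def)
  have D_B2: "D ! (d2 + i) = B2 ! i" if "i < length B2" for i
    using that by (simp add: D_def tb_def la_def d1_def d2_def nth_append n_def)
  have base: "base S \<le> card S + 1" "0 < base S" "card S \<le> n" if "S \<in> nodes T" for S
  proof -
    have "S \<subseteq> {1..n}" "S \<noteq> {}" using that nodes_subset[of T] by (auto simp: n_def)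
    then show "base S \<le> card S + 1" "0 < base S" "card S \<le> n"
      using finite_subset[of S "{1..n}"] card_mono[of "{1..n}" S]
      by (auto simp: base_def card_gt_0_iff intro!: level_bound_level)
  qed
  have D_head: "D ! j = field {} ! j" if "j < 8" for j
    using D_rec[of "{}" j] that by (simp add: addr0)
  have rec_less: "addr S + 8 \<le> length D" if "S \<in> insert {} (nodes T)" for S
    using addr_less[OF that] by (simp add: lenD Z_def d2_def d1_def la_def tb_def)
  have leaves: "leaves_ok w D (n + 1) S (addr S)" if "S \<in> insert {} (nodes T)" for S
  proof (cases "S = {}")
    case True
    \<comment> \<open>The header words \<open>d2\<close> and \<open>n + 1\<close> are read as source
      and divisor, harmlessly: there are no entries and no buckets.\<close>
    have "field S ! 2 = d2" "field S ! 3 = 0" "field S ! 4 = 0" "field S ! 5 = n + 1"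
      using True by (simp_all add: field_def)
    then have "D ! (addr S + 2) = d2" "D ! (addr S + 3) = 0" "D ! (addr S + 4) = 0" "D ! (addr S + 5) = n + 1"
      using D_rec[OF that] by simp_all
    then show ?thesis unfolding leaves_ok_def using True rec_less[OF that]
      by (intro exI[of _ "[]"] exI[of _ 0] exI[of _ "n + 1"] exI[of _ d2])
        (simp add: lenD Z_def bucket_pass_def)
  next
    case False
    then have S: "S \<in> nodes T" using that by simp
    define b where "b = base S"
    define ks where "ks = take (card S) (drop (start S) (suffix_array T))"
    have "field S ! 2 = la + start S" "field S ! 3 = card S" "field S ! 4 = b" "field S ! 5 = (n + 1) * (b * b)"
      using False by (simp_all add: field_def b_def)
    then have f: "D ! (addr S + 2) = la + start S" "D ! (addr S + 3) = card S" "D ! (addr S + 4) = b"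
      "D ! (addr S + 5) = (n + 1) * (b * b)"
      using D_rec[OF that] by simp_all
    have ks: "set ks = S" "distinct ks" "length ks = card S"
      using start[OF S] by (simp_all add: ks_def n_def)
    have at: "D ! (la + start S + i) = map (leaf_entry T) ks ! i" if "i < card S" for i
      using D_leaf[of "start S + i"] start(1)[OF S] that by (simp add: ks_def n_def add.assoc)
    have "b \<le> N" using base[OF S] by (simp add: b_def N_def)
    then have "N * (b * b) * b \<le> N * (N * N) * N" by (intro mult_mono) auto
    also have "\<dots> = 1 * N ^ 4" by (simp add: power4_eq_xxxx)
    also have "\<dots> < 2 ^ w" by (rule small) auto
    finally have pb: "(n + 1) * (b * b) * b < 2 ^ w" by (simp only: N_def)
    have "la + start S + card S \<le> length D"
      using start(1)[OF S] by (simp add: lenD Z_def d2_def d1_def)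
    then show ?thesis unfolding leaves_ok_def
      using f ks at base[OF S] pb rec_less[OF that]
        sort_leaf_entries[OF S ks(1,2), of b "(n + 1) * (b * b)"]
      by (intro exI[of _ "map (leaf_entry T) ks"] exI[of _ b] exI[of _ "(n + 1) * (b * b)"]
          exI[of _ "la + start S"]) (simp add: b_def base_def n_def)
  qed
  have Zs: "Z < 2 ^ w" using Zw by simp
  have field_less: "field S ! j < 2 ^ w" if "S \<in> insert {} (nodes T)" "j < 8" for S j
  proof -
    have "\<forall>x \<in> set (field S). x < 2 ^ w"
    proof (cases "S = {}")
      case True
      then show ?thesis using Zw by (simp add: field_def Z_def d2_def)
    next
      case False
      then have S: "S \<in> nodes T" using that by simp
      have sub: "S \<subseteq> {1..n}" "S \<noteq> {}" using S nodes_subset[of T] by (auto simp: n_def)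
      then have "finite S" by (meson finite_atLeastAtMost finite_subset)
      then have "Min S \<in> S" using sub by simp
      then have "Min S \<le> n" using sub by auto
      moreover have "length (label T S) \<le> n"
        using length_le_if_occurs[of T "label T S"] occurrences_label_node[OF S] False by (simp add: n_def)
      moreover have "(n + 1) * (base S * base S) < 2 ^ w"
      proof -
        have "base S \<le> N" using base[OF S] by (simp add: N_def)
        then have "N * (base S * base S) \<le> N * (N * N)" by (intro mult_mono) auto
        also have "\<dots> = 1 * N ^ 3" by (simp add: power3_eq_cube)
        also have "\<dots> < 2 ^ w" by (rule small) auto
        finally show ?thesis by (simp only: N_def)
      qed
      ultimately show ?thesis using False Zs Zw start(1)[OF S] base[OF S]
        by (simp add: field_def Z_def d2_def d1_def la_def)
    qed
    moreover have "length (field S) = 8" by (simp add: field_def)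
    ultimately show ?thesis using that(2) by simp
  qed
  have "D \<in> words w"
  proof -
    have "leaf_entry T k < 2 ^ w" if "k \<in> {1..n}" for k
      using leaf_entry_less[of k T] T that small[of 1 5] by (simp add: N_def n_def)
    then have "\<forall>x \<in> set (map (leaf_entry T) (suffix_array T)). x < 2 ^ w" by (auto simp: n_def)
    moreover have "field (Gs ! (a div 8)) ! (a mod 8) < 2 ^ w" if "a < 8 * g" for a
    proof (rule field_less)
      have "a div 8 < g" using that by simp
      then show "Gs ! (a div 8) \<in> insert {} (nodes T)" using Gs(2) by (metis g_def nth_mem)
    qed simp
    ultimately show ?thesis using T B1 B2 by (auto simp: words_def D_def)
  qed
  have "text_index w T D addr rank child n tb d1 d2 B1 B2"
  proof
    show "n = length T" by (rule n_def)
    show "D \<in> words w" by fact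
    show "length D + 4 * (n + 1) < 2 ^ w" using Zw by (simp add: lenD)
    show "7 < length D" using rec_less[of "{}"] by (simp add: addr0)
    show "D ! 0 = 0" "D ! 1 = d1" "D ! 2 = d2" "D ! 5 = n + 1" "D ! 6 = length D"
      using D_head by (simp_all add: field_def lenD)
    show "d1 + length B1 \<le> length D" "d2 + length B2 \<le> length D" "tb + n \<le> length D"
      by (simp_all add: lenD Z_def d2_def d1_def la_def)
    show "addr (occurrences T []) = 8" using addr1 by (simp add: root_def)
    show "D ! addr S = length (label T S)" if "S \<in> nodes T" for S
      using D_rec[of S 0] that ne by (auto simp: field_def)
    show "\<exists>k\<in>S. D ! (addr S + 1) = tb + (k - 1)" if "S \<in> nodes T" for S
    proof
      have "S \<subseteq> {1..n}" "S \<noteq> {}" using that nodes_subset[of T] by (auto simp: n_def)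
      then show "Min S \<in> S" by (meson Min_in finite_atLeastAtMost finite_subset)
      show "D ! (addr S + 1) = tb + (Min S - 1)"
        using D_rec[of S 1] that ne by (auto simp: field_def)
    qed
  qed (use B1 B2 D_B1 D_B2 D_T leaves addr0 rank_le addr_w child_node child_dead in auto)
  then show ?thesis using Z lenD n_def by metis
qed

theorem theorem1:
  "\<exists>c\<^sub>0::real. c\<^sub>0 > 0 \<and> (\<forall>c\<^sub>1::real. \<exists>(Q::prog) (C::nat). \<forall>(w::nat) (T::nat list).
     T \<noteq> [] \<and> T \<in> words w \<and>
     c\<^sub>0 * log 2 (real (length T) + 1) \<le> real w \<and> real w \<le> c\<^sub>1 * log 2 (real (length T) + 1) \<longrightarrow>
     (\<exists>D \<in> words w. length D \<le> C * length T \<and>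
        (\<forall>P \<in> words w.
           answers_within w Q D P (sorted_list_of_set (occurrences T P))
             (C * (length P + card (occurrences T P))))))"
proof (intro exI[of _ "28::real"] conjI allI exI[of _ query] exI[of _ "400::nat"] impI)
  fix c\<^sub>1 :: real and w :: nat and T :: "nat list"
  assume *: "T \<noteq> [] \<and> T \<in> words w \<and>
     28 * log 2 (real (length T) + 1) \<le> real w \<and> real w \<le> c\<^sub>1 * log 2 (real (length T) + 1)"
  define N where "N = length T + 1"
  have N2: "2 \<le> N" using * by (simp add: N_def Suc_le_eq)
  have "real (N ^ 28) = real N powr 28" using N2 by (simp add: powr_numeral)
  also have "real N = 2 powr log 2 (real N)" using N2 by simp
  also have "(2 powr log 2 (real N)) powr 28 = 2 powr (28 * log 2 (real N))"
    by (simp only: powr_powr mult.commute)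
  also have "\<dots> \<le> 2 powr real w" using * by (intro powr_mono) (auto simp: N_def add.commute)
  also have "\<dots> = real (2 ^ w)" by (simp add: powr_realpow)
  finally have "N ^ 28 \<le> 2 ^ w" by (simp only: of_nat_le_iff)
  moreover have "2 ^ 20 * N ^ 8 \<le> N ^ 20 * N ^ 8" using N2 by (intro mult_right_mono power_mono) auto
  ultimately have "2 ^ 20 * N ^ 8 \<le> 2 ^ w" by (simp flip: power_add)
  then obtain D addr rank child tb d1 d2 B1 B2 where
    "text_index w T D addr rank child (length T) tb d1 d2 B1 B2" and len: "length D \<le> 310 * length T"
    using exists_text_index[of T w] * by (auto simp: N_def)
  then interpret text_index w T D addr rank child "length T" tb d1 d2 B1 B2 by simp
  have "answers_within w query D P (sorted_list_of_set (occurrences T P))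
      (400 * (length P + card (occurrences T P)))" if P: "P \<in> words w" for P
  proof -
    \<comment> \<open>The additive 200 must be absorbed into the product. The only pattern of length
      0 occurs everywhere in the nonempty text.\<close>
    have "0 < length P + card (occurrences T P)"
    proof (cases P)
      case Nil
      then have "1 \<in> occurrences T P" using * by (simp add: occurrences_eq Suc_le_eq One_nat_def)
      then show ?thesis using card_gt_0_iff finite_occurrences by fastforce
    qed simp
    then have "100 * length P + 100 * card (occurrences T P) + 200 \<le> 400 * (length P + card (occurrences T P))"
      by arith
    then show ?thesis using answers_query[OF P] unfolding answers_within_def by (meson le_trans)
  qed
  then show "\<exists>D \<in> words w. length D \<le> 400 * length T \<and>
        (\<forall>P \<in> words w. answers_within w query D P (sorted_list_of_set (occurrences T P))
             (400 * (length P + card (occurrences T P))))"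
    using D(1) len by (intro bexI[of _ D]) auto
qed simp

end
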